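(* Let the convex discrete-time problem (P4) satisfy the regularity assumption (A-reg), the full-rank assumption (A-rank), Slater's condition (A-Slater) and the normality assumption (A-normal), and let the pair $\{A,B\}$ be controllable. Then there exists $\epsilon>0$ such that, if the vector $q\in\mathbb{R}^d$ is uniformly distributed over the cube $\epsilon\mathbb{D}=\{q\in\mathbb{R}^d : -\epsilon\le q_i\le\epsilon\ \text{for all } i\}$, the probability that the optimal trajectory $(x,u,\sigma)$ of the perturbed problem (P8) with parameter $q$ violates the nonconvex constraint $\rho_{\min}\le g(u_i)\le\rho_{\max}$ at more than $n_x-1$ grid points $i\in\{1,\dots,N\}$ is zero.
   Context: Data: $A\in\mathbb{R}^{n_x\times n_x}$, $B\in\mathbb{R}^{n_x\times n_u}$, $x_{\rm init}\in\mathbb{R}^{n_x}$, a number $N$ of temporal grid points, fixed real constants $\rho_{\min},\rho_{\max}$; functions $m:\mathbb{R}^{n_x}\to\mathbb{R}$, $g:\mathbb{R}^{n_u}\to\mathbb{R}$, $l_i:\mathbb{R}\to\mathbb{R}$ ($i=1,\dots,N$), convex and $C^1$; $G:\mathbb{R}^{n_x}\to\mathbb{R}^{n_G}$ affine. Problem (P4): minimize $m(x_{N+1})+\sum_{i=1}^N l_i(\sigma_i)$ over $x=(x_1,\dots,x_{N+1})$, $u=(u_1,\dots,u_N)$, $\sigma=(\sigma_1,\dots,\sigma_N)$ with $x_i\in\mathbb{R}^{n_x}$, $u_i\in\mathbb{R}^{n_u}$, $\sigma_i\in\mathbb{R}$, subject to $x_{i+1}=Ax_i+Bu_i$, $\rho_{\min}\le\sigma_i\le\rho_{\max}$,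 $g(u_i)\le\sigma_i$ for $i=1,\dots,N$, $x_1=x_{\rm init}$, $G(x_{N+1})=0$. It is the convex relaxation of the nonconvex problem in which there is no $\sigma$, the cost is $m(x_{N+1})+\sum_{i=1}^N l_i(g(u_i))$, and the control constraint is $\rho_{\min}\le g(u_i)\le\rho_{\max}$ for all $i$. Problem (P7): minimize $m(x_{N+1})$ over $x_{N+1}\in\mathbb{R}^{n_x}$ subject to $G(x_{N+1})=0$. Write $z=(x,u,\sigma)$, $V=\{(\bar u,\bar\sigma)\in\mathbb{R}^{n_u}\times\mathbb{R}:\rho_{\min}\le\bar\sigma\le\rho_{\max},\ g(\bar u)\le\bar\sigma\}$, $\tilde V=\{z:(u_i,\sigma_i)\in V\ \forall i\}$, and let $H(z)=0$ collect all affine equality constraints (dynamics, initial condition, boundary condition), redundant boundary equations having been eliminated if necessary. Assumptions on (P4). (A-reg): each $l_i$ is $C^1$ and monotonically increasing on $[\rho_{\min},\infty)$; $m$ is $C^1$; $\{u: g(u_i)\le\rho_{\min}\ \forall i\}$ is nonempty and $\{u: g(u_i)\le\rho_{\max}\ \forall i\}$ is compact. (A-rank): the (constant) Jacobian $\nabla H$ has full row rank. (A-Slater): there is $z$ in the interior of $\tilde V$ with $H(z)=0$. (A-normal): (P4) is normal, i.e. at the optimal solution $(x,u,\sigma)$ of (P4) either $\sigma_i>\rho_{\min}$ for some $i$, or $x_{N+1}$ is not a minimizer of (P7). Controllability: $\operatorname{rank}(B, AB, \dots, A^{n_x-1}B)=n_x$. Perturbation: let $A=Q^{-1}JQ$ be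 the Jordan form of $A$ and $\lambda_1,\dots,\lambda_d$ the distinct eigenvalues of $A$. For $q=(q_1,\dots,q_d)\in\mathbb{R}^d$, $\tilde A(q)=Q^{-1}\tilde JQ$, where $\tilde J$ is the Jordan matrix identical to $J$ except for its diagonal entries: in every Jordan block belonging to $\lambda_i$ the diagonal entry $\lambda_i$ is replaced by $\tilde\lambda_i=\lambda_i+q_i$, the block structure being unchanged. Problem (P8) with parameter $q$ is (P4) with $A$ replaced by $\tilde A(q)$.
   Formalization: For a nonreal conjugate pair of eigenvalues of A both get the same shift q_i (that of the one with positive imaginary part), as independent shifts make the perturbed matrix nonreal and (P8) undefined; "monotonically increasing" is read as strictly increasing. *)

theory Defs
  imports
    "HOL-Analysis.Analysis"
    "Jordan_Normal_Form.Jordan_Normal_Form"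
begin

no_notation vec_index (infixl \<open>$\<close> 100)

definition C1_fun :: "('a::real_inner \<Rightarrow> real) \<Rightarrow> bool" where
  "C1_fun f \<longleftrightarrow> (\<exists>D. (\<forall>x. GDERIV f x :> D x) \<and> continuous_on UNIV D)"

(* Grid points are the naturals 1..num_pts.  A record for the data makes "the same problem
   with the system matrix replaced" a record update. *)
record ('nx, 'nu, 'ng) ocp =
  sysA :: "real^'nx^'nx"
  sysB :: "real^'nu^'nx"
  x_init :: "real^'nx"
  num_pts :: nat
  rho_min :: real
  rho_max :: real
  mcost :: "real^'nx \<Rightarrow> real"
  gfun :: "real^'nu \<Rightarrow> real"
  lcost :: "nat \<Rightarrow> real \<Rightarrow> real"
  bdry :: "real^'nx \<Rightarrow> real^'ng"

type_synonym ('nx, 'nu) traj = "(nat \<Rightarrow> real^'nx) \<times> (nat \<Rightarrow> real^'nu) \<times> (nat \<Rightarrow> real)"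

definition ocp_data :: "('nx::finite, 'nu::finite, 'ng::finite) ocp \<Rightarrow> bool" where
  "ocp_data P \<longleftrightarrow>
     convex_on UNIV (mcost P) \<and> C1_fun (mcost P) \<and>
     convex_on UNIV (gfun P) \<and> C1_fun (gfun P) \<and>
     (\<forall>i\<in>{1..num_pts P}. convex_on UNIV (lcost P i) \<and> C1_fun (lcost P i)) \<and>
     linear (\<lambda>x. bdry P x - bdry P 0)"

(* The space of all z = (x, u, sigma), i.e. the finite product
   (R^nx)^(N+1) x (R^nu)^N x R^N; its points are extensional functions on the index ranges. *)
definition traj_space :: "('nx::finite, 'nu::finite, 'ng::finite) ocp \<Rightarrow> ('nx, 'nu) traj topology" where
  "traj_space P =
     prod_topology (product_topology (\<lambda>_. euclidean) {1..num_pts P + 1})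
       (prod_topology (product_topology (\<lambda>_. euclidean) {1..num_pts P})
          (product_topology (\<lambda>_. euclidean) {1..num_pts P}))"

definition V_set :: "('nx::finite, 'nu::finite, 'ng::finite) ocp \<Rightarrow> ((real^'nu) \<times> real) set" where
  "V_set P = {(v, s). rho_min P \<le> s \<and> s \<le> rho_max P \<and> gfun P v \<le> s}"

definition V_tilde :: "('nx::finite, 'nu::finite, 'ng::finite) ocp \<Rightarrow> ('nx, 'nu) traj set" where
  "V_tilde P = {(x, u, \<sigma>) \<in> topspace (traj_space P). \<forall>i\<in>{1..num_pts P}. (u i, \<sigma> i) \<in> V_set P}"

(* H(z) = 0, where only the boundary equations with index in K are retained in H. *)
definition H_zero :: "('nx::finite, 'nu::finite, 'ng::finite) ocp \<Rightarrow> 'ng set \<Rightarrow> ('nx, 'nu) traj set" where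
  "H_zero P K = {(x, u, \<sigma>) \<in> topspace (traj_space P).
     (\<forall>i\<in>{1..num_pts P}. x (i + 1) = sysA P *v x i + sysB P *v u i) \<and>
     x 1 = x_init P \<and>
     (\<forall>k\<in>K. bdry P (x (num_pts P + 1)) $ k = 0)}"

(* The rows of the Jacobian of H are linearly independent: p, a and b are the coefficients of the
   rows belonging to the dynamics, the initial and the retained boundary equations, and the sum
   is the corresponding combination of rows applied to the direction (x, u, sigma).  All
   equations are affine, so each row is the linear part of its equation; sigma does not enter. *)
definition full_row_rank_H :: "('nx::finite, 'nu::finite, 'ng::finite) ocp \<Rightarrow> 'ng set \<Rightarrow> bool" where
  "full_row_rank_H P K \<longleftrightarrow>
     (\<forall>(p :: nat \<Rightarrow> real^'nx) (a :: real^'nx) (b :: real^'ng).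
        (\<forall>k. k \<notin> K \<longrightarrow> b $ k = 0) \<longrightarrow>
        (\<forall>(x, u, \<sigma>) \<in> topspace (traj_space P).
           (\<Sum>i = 1..num_pts P. inner (p i) (x (i + 1) - (sysA P *v x i + sysB P *v u i)))
           + inner a (x 1)
           + inner b (bdry P (x (num_pts P + 1)) - bdry P 0) = 0) \<longrightarrow>
        (\<forall>i\<in>{1..num_pts P}. p i = 0) \<and> a = 0 \<and> b = 0)"

definition relaxed_feasible :: "('nx::finite, 'nu::finite, 'ng::finite) ocp \<Rightarrow> ('nx, 'nu) traj set" where
  "relaxed_feasible P = {(x, u, \<sigma>) \<in> topspace (traj_space P).
     (\<forall>i\<in>{1..num_pts P}. x (i + 1) = sysA P *v x i + sysB P *v u i \<and>
        rho_min P \<le> \<sigma> i \<and> \<sigma> i \<le> rho_max P \<and> gfun P (u i) \<le> \<sigma> i) \<and>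
     x 1 = x_init P \<and>
     bdry P (x (num_pts P + 1)) = 0}"

definition relaxed_cost :: "('nx::finite, 'nu::finite, 'ng::finite) ocp \<Rightarrow> ('nx, 'nu) traj \<Rightarrow> real" where
  "relaxed_cost P = (\<lambda>(x, u, \<sigma>). mcost P (x (num_pts P + 1)) + (\<Sum>i = 1..num_pts P. lcost P i (\<sigma> i)))"

definition relaxed_optimal :: "('nx::finite, 'nu::finite, 'ng::finite) ocp \<Rightarrow> ('nx, 'nu) traj \<Rightarrow> bool" where
  "relaxed_optimal P z \<longleftrightarrow> z \<in> relaxed_feasible P \<and> (\<forall>z'\<in>relaxed_feasible P. relaxed_cost P z \<le> relaxed_cost P z')"

definition terminal_minimizer :: "('nx::finite, 'nu::finite, 'ng::finite) ocp \<Rightarrow> real^'nx \<Rightarrow> bool" where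
  "terminal_minimizer P y \<longleftrightarrow> bdry P y = 0 \<and> (\<forall>w. bdry P w = 0 \<longrightarrow> mcost P y \<le> mcost P w)"

(* "Monotonically increasing" is strict.  With merely nondecreasing running costs (e.g. all zero)
   the optimal controls are not determined and lossless convexification fails. *)
definition A_reg :: "('nx::finite, 'nu::finite, 'ng::finite) ocp \<Rightarrow> bool" where
  "A_reg P \<longleftrightarrow>
     (\<forall>i\<in>{1..num_pts P}. C1_fun (lcost P i) \<and> strict_mono_on {rho_min P..} (lcost P i)) \<and>
     C1_fun (mcost P) \<and>
     ({1..num_pts P} \<rightarrow>\<^sub>E {v. gfun P v \<le> rho_min P}) \<noteq> {} \<and>
     compactin (product_topology (\<lambda>_. euclidean) {1..num_pts P})
       ({1..num_pts P} \<rightarrow>\<^sub>E {v. gfun P v \<le> rho_max P})"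

(* The first conjunct says that the boundary equations left out of H are redundant. *)
definition A_rank :: "('nx::finite, 'nu::finite, 'ng::finite) ocp \<Rightarrow> 'ng set \<Rightarrow> bool" where
  "A_rank P K \<longleftrightarrow> H_zero P K = H_zero P UNIV \<and> full_row_rank_H P K"

definition A_Slater :: "('nx::finite, 'nu::finite, 'ng::finite) ocp \<Rightarrow> 'ng set \<Rightarrow> bool" where
  "A_Slater P K \<longleftrightarrow> (\<exists>z \<in> traj_space P interior_of V_tilde P. z \<in> H_zero P K)"

definition A_normal :: "('nx::finite, 'nu::finite, 'ng::finite) ocp \<Rightarrow> bool" where
  "A_normal P \<longleftrightarrow>
     (\<forall>x u \<sigma>. relaxed_optimal P (x, u, \<sigma>) \<longrightarrow>
        (\<exists>i\<in>{1..num_pts P}. \<sigma> i > rho_min P) \<or> \<not> terminal_minimizer P (x (num_pts P + 1)))"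

(* a fixed enumeration of a finite index type by 0, ..., CARD('n) - 1 *)
definition ix :: "'n::finite \<Rightarrow> nat" where
  "ix = to_nat_on UNIV"

lemma bij_betw_ix: "bij_betw (ix :: 'n::finite \<Rightarrow> nat) UNIV {..<CARD('n)}"
  unfolding ix_def by (rule to_nat_on_finite) simp

(* (^) on the type of square matrices is componentwise. *)
definition mat_pow :: "'a::semiring_1^'n^'n \<Rightarrow> nat \<Rightarrow> 'a^'n^'n" where
  "mat_pow M k = ((\<lambda>X. M ** X) ^^ k) (Finite_Cartesian_Product.mat 1)"

(* The columns of (B, AB, ..., A^(n-1) B) are indexed by pairs (power, column of B). *)
definition ctrb_matrix :: "real^'n^'n \<Rightarrow> real^'u^'n \<Rightarrow> real^('n::finite \<times> 'u::finite)^'n" where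
  "ctrb_matrix M B = (\<chi> i jk. (mat_pow M (ix (fst jk)) ** B) $ i $ snd jk)"

definition controllable :: "real^'n^'n \<Rightarrow> real^'u^'n \<Rightarrow> bool" where
  "controllable M B \<longleftrightarrow> rank (ctrb_matrix M B) = CARD('n::finite)"

definition eigenvalues :: "real^'n^'n \<Rightarrow> complex set" where
  "eigenvalues M = {c. \<exists>v. v \<noteq> 0 \<and> map_matrix complex_of_real M *v v = c *s v}"

definition jordan_cart :: "(nat \<times> complex) list \<Rightarrow> complex^'n^'n::finite" where
  "jordan_cart bs = (\<chi> i j. jordan_matrix bs $$ (ix i, ix j))"

definition jordan_form :: "real^'n^'n \<Rightarrow> complex^'n^'n \<Rightarrow> (nat \<times> complex) list \<Rightarrow> bool" where
  "jordan_form M Q bs \<longleftrightarrow>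
     invertible Q \<and> 0 \<notin> fst ` set bs \<and> sum_list (map fst bs) = CARD('n::finite) \<and>
     map_matrix complex_of_real M = matrix_inv Q ** jordan_cart bs ** Q"

(* ev enumerates the distinct eigenvalues and a real eigenvalue ev i is moved to ev i + q $ i.
   The shifted matrix has to be real, so the two members of a pair of nonreal conjugate eigenvalues
   get a common shift, namely the component of q belonging to the one with positive imaginary
   part. *)
definition shift_ev :: "('d::finite \<Rightarrow> complex) \<Rightarrow> real^'d \<Rightarrow> complex \<Rightarrow> complex" where
  "shift_ev ev q c = c + complex_of_real (q $ inv_into UNIV ev (Complex (Re c) (\<bar>Im c\<bar>)))"

definition perturbed_cmatrix ::
  "complex^'n^'n \<Rightarrow> (nat \<times> complex) list \<Rightarrow> ('d::finite \<Rightarrow> complex) \<Rightarrow> real^'d \<Rightarrow> complex^'n^'n::finite" where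
  "perturbed_cmatrix Q bs ev q =
     matrix_inv Q ** jordan_cart (map (\<lambda>(k, c). (k, shift_ev ev q c)) bs) ** Q"

(* The real parts lose nothing, see of_real_perturbed_matrix below. *)
definition perturbed_matrix ::
  "complex^'n^'n \<Rightarrow> (nat \<times> complex) list \<Rightarrow> ('d::finite \<Rightarrow> complex) \<Rightarrow> real^'d \<Rightarrow> real^'n^'n::finite" where
  "perturbed_matrix Q bs ev q = map_matrix Re (perturbed_cmatrix Q bs ev q)"

lemma jordan_matrix_offdiag:
  fixes bs :: "(nat \<times> complex) list"
  assumes "i < sum_list (map fst bs)" "j < sum_list (map fst bs)" "i \<noteq> j"
    and "jordan_matrix bs $$ (i, j) \<noteq> 0"
  shows "j = Suc i \<and> jordan_matrix bs $$ (i, i) = jordan_matrix bs $$ (j, j)"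
  using assms
proof (induction bs arbitrary: i j)
  case Nil
  then show ?case by simp
next
  case (Cons b bs)
  obtain n c where b: "b = (n, c)" by (cases b)
  let ?s = "sum_list (map fst bs)"
  have ij: "i < n + ?s" "j < n + ?s" using Cons.prems b by auto
  show ?case
  proof (cases "i < n \<or> j < n")
    case True
    then show ?thesis
      using Cons.prems ij unfolding b jordan_matrix_Cons
      by (auto split: if_splits)
  next
    case False
    have nz: "jordan_matrix bs $$ (i - n, j - n) \<noteq> 0"
      using Cons.prems(4) ij False unfolding b jordan_matrix_Cons by auto
    have "j - n = Suc (i - n) \<and>
      jordan_matrix bs $$ (i - n, i - n) = jordan_matrix bs $$ (j - n, j - n)"
      by (rule Cons.IH) (use ij False nz Cons.prems(3) in auto)
    then show ?thesis
      using ij False unfolding b jordan_matrix_Cons by auto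
  qed
qed

lemma jordan_matrix_map_diag:
  fixes bs :: "(nat \<times> complex) list"
  assumes "i < sum_list (map fst bs)" "j < sum_list (map fst bs)"
  shows "jordan_matrix (map (\<lambda>(k, c). (k, f c)) bs) $$ (i, j) =
    (if i = j then f (jordan_matrix bs $$ (i, i)) else jordan_matrix bs $$ (i, j))"
  using assms
proof (induction bs arbitrary: i j)
  case Nil
  then show ?case by simp
next
  case (Cons b bs)
  obtain n c where b: "b = (n, c)" by (cases b)
  let ?s = "sum_list (map fst bs)"
  have s: "sum_list (map fst (map (\<lambda>(k, c). (k, f c)) bs)) = ?s"
    by (induction bs) auto
  have ij: "i < n + ?s" "j < n + ?s" using Cons.prems b by auto
  have eq: "map (\<lambda>(k, c). (k, f c)) (b # bs) = (n, f c) # map (\<lambda>(k, c). (k, f c)) bs"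
    by (simp add: b)
  show ?case
  proof (cases "i < n \<or> j < n")
    case True
    then show ?thesis
      using ij s unfolding eq unfolding b jordan_matrix_Cons by auto
  next
    case False
    have "jordan_matrix (map (\<lambda>(k, c). (k, f c)) bs) $$ (i - n, j - n) =
      (if i - n = j - n then f (jordan_matrix bs $$ (i - n, i - n)) else jordan_matrix bs $$ (i - n, j - n))"
      by (rule Cons.IH) (use ij False in auto)
    then show ?thesis
      using ij s False unfolding eq unfolding b jordan_matrix_Cons by auto
  qed
qed

lemma of_real_perturbed_matrix:
  fixes M :: "real^'n^'n::finite" and q :: "real^'d::finite"
  assumes "jordan_form M Q bs"
  shows "map_matrix complex_of_real (perturbed_matrix Q bs ev q) = perturbed_cmatrix Q bs ev q"
proof -
  let ?f = "shift_ev ev q"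
  define s where "s c = complex_of_real (q $ inv_into UNIV ev (Complex (Re c) (\<bar>Im c\<bar>)))" for c
  define J where "J = (jordan_cart bs :: complex^'n^'n)"
  define S :: "complex^'n^'n" where "S = (\<chi> i j. if i = j then s (J $ i $ i) else 0)"
  define cm :: "complex^'n^'n \<Rightarrow> complex^'n^'n" where "cm = map_matrix cnj"
  have invQ: "invertible Q" and sum: "sum_list (map fst bs) = CARD('n)"
    and M: "map_matrix complex_of_real M = matrix_inv Q ** J ** Q"
    using assms unfolding jordan_form_def J_def by auto
  have ixlt: "ix (i::'n) < CARD('n)" for i using bij_betw_ix unfolding bij_betw_def by blast
  have ixinj: "ix (i::'n) = ix j \<longleftrightarrow> i = j" for i j
    using bij_betw_ix unfolding bij_betw_def inj_on_def by blast
  have cm_mult: "cm (X ** Y) = cm X ** cm Y" for X Y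
    unfolding cm_def matrix_matrix_mult_def by (simp add: Finite_Cartesian_Product.vec_eq_iff)
  have cm_add: "cm (X + Y) = cm X + cm Y" for X Y
    unfolding cm_def by (simp add: Finite_Cartesian_Product.vec_eq_iff)
  have cm_1: "cm (Finite_Cartesian_Product.mat 1) = Finite_Cartesian_Product.mat 1"
    unfolding cm_def Finite_Cartesian_Product.mat_def by (auto simp: Finite_Cartesian_Product.vec_eq_iff)
  have shifted: "jordan_cart (map (\<lambda>(k, c). (k, ?f c)) bs) = J + S"
    unfolding J_def S_def jordan_cart_def Finite_Cartesian_Product.vec_eq_iff
    using jordan_matrix_map_diag[of _ bs _ ?f] ixlt sum
    by (auto simp: ixinj shift_ev_def s_def)
  have QQ: "Q ** matrix_inv Q = Finite_Cartesian_Product.mat 1"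
      "matrix_inv Q ** Q = Finite_Cartesian_Product.mat 1"
    using someI_ex[OF invQ[unfolded invertible_def]] unfolding matrix_inv_def by auto
  define C R where "C = cm Q" and "R = cm (matrix_inv Q)"
  have CR: "C ** R = Finite_Cartesian_Product.mat 1" "R ** C = Finite_Cartesian_Product.mat 1"
    unfolding C_def R_def using QQ cm_1 by (metis cm_mult)+
  define T where "T = Q ** R"
  have "cm (map_matrix complex_of_real M) = map_matrix complex_of_real M"
    unfolding cm_def by (simp add: Finite_Cartesian_Product.vec_eq_iff)
  then have eqM: "R ** cm J ** C = matrix_inv Q ** J ** Q"
    unfolding M C_def R_def cm_mult .
  have "T ** cm J = Q ** (R ** cm J ** C) ** R"
    unfolding T_def using CR by (metis matrix_mul_assoc matrix_mul_rid)
  also have "\<dots> = J ** T"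
    unfolding eqM T_def using QQ by (metis matrix_mul_assoc matrix_mul_lid)
  finally have TJ: "T ** cm J = J ** T" .
  have offdiag: "ix j = Suc (ix i) \<and> J $ i $ i = J $ j $ j" if "i \<noteq> j" "J $ i $ j \<noteq> 0" for i j
    using jordan_matrix_offdiag[of "ix i" bs "ix j"] that ixlt sum ixinj
    unfolding J_def jordan_cart_def by auto
  have T0: "T $ i $ j = 0" if "J $ i $ i \<noteq> cnj (J $ j $ j)" for i j
    using that
  proof (induction "(CARD('n) - ix i) + ix j" arbitrary: i j rule: less_induct)
    case less
    have "(T ** cm J) $ i $ j = (\<Sum>k\<in>UNIV. T $ i $ k * cnj (J $ k $ j))"
      unfolding matrix_matrix_mult_def cm_def by simp
    also have "\<dots> = (\<Sum>k\<in>UNIV. if k = j then T $ i $ j * cnj (J $ j $ j) else 0)"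
    proof (rule sum.cong[OF refl])
      fix k
      show "T $ i $ k * cnj (J $ k $ j) = (if k = j then T $ i $ j * cnj (J $ j $ j) else 0)"
      proof (cases "k = j \<or> J $ k $ j = 0")
        case False
        then have k: "ix j = Suc (ix k)" "J $ k $ k = J $ j $ j" using offdiag by auto
        have "T $ i $ k = 0" by (rule less.hyps) (use k less.prems in auto)
        then show ?thesis using False by simp
      qed auto
    qed
    also have "\<dots> = T $ i $ j * cnj (J $ j $ j)" by simp
    finally have l: "(T ** cm J) $ i $ j = T $ i $ j * cnj (J $ j $ j)" .
    have "(J ** T) $ i $ j = (\<Sum>k\<in>UNIV. J $ i $ k * T $ k $ j)"
      unfolding matrix_matrix_mult_def by simp
    also have "\<dots> = (\<Sum>k\<in>UNIV. if k = i then J $ i $ i * T $ i $ j else 0)"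
    proof (rule sum.cong[OF refl])
      fix k
      show "J $ i $ k * T $ k $ j = (if k = i then J $ i $ i * T $ i $ j else 0)"
      proof (cases "k = i \<or> J $ i $ k = 0")
        case False
        then have k: "ix k = Suc (ix i)" "J $ i $ i = J $ k $ k" using offdiag by auto
        have "CARD('n) - ix k < CARD('n) - ix i" using k(1) ixlt[of i] by linarith
        then have "T $ k $ j = 0" by (intro less.hyps) (use k less.prems in auto)
        then show ?thesis using False by simp
      qed auto
    qed
    also have "\<dots> = J $ i $ i * T $ i $ j" by simp
    finally have "(J ** T) $ i $ j = J $ i $ i * T $ i $ j" .
    then have "(J $ i $ i - cnj (J $ j $ j)) * T $ i $ j = 0"
      using l TJ by (simp add: algebra_simps)
    then show ?case using less.prems by simp
  qed
  have s_cnj: "s (cnj c) = s c" for c unfolding s_def by simp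
  have "S ** T = T ** S"
    unfolding Finite_Cartesian_Product.vec_eq_iff
  proof (intro allI)
    fix i j
    have "(S ** T) $ i $ j = s (J $ i $ i) * T $ i $ j"
      unfolding matrix_matrix_mult_def S_def by (simp add: if_distrib[of "\<lambda>x. x * _"] cong: if_cong)
    moreover have "(T ** S) $ i $ j = T $ i $ j * s (J $ j $ j)"
      unfolding matrix_matrix_mult_def S_def by (simp add: if_distrib[of "\<lambda>x. _ * x"] cong: if_cong)
    ultimately show "(S ** T) $ i $ j = (T ** S) $ i $ j"
      using T0[of i j] s_cnj by (cases "J $ i $ i = cnj (J $ j $ j)") auto
  qed
  then have "matrix_inv Q ** (S ** T) ** C = matrix_inv Q ** (T ** S) ** C" by simp
  moreover have "matrix_inv Q ** (S ** T) ** C = matrix_inv Q ** S ** Q"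
    unfolding T_def using CR by (metis matrix_mul_assoc matrix_mul_rid)
  moreover have "matrix_inv Q ** (T ** S) ** C = R ** S ** C"
    unfolding T_def using QQ by (metis matrix_mul_assoc matrix_mul_lid)
  ultimately have eqS: "R ** S ** C = matrix_inv Q ** S ** Q" by simp
  have cmS: "cm S = S" unfolding cm_def S_def s_def by (auto simp: Finite_Cartesian_Product.vec_eq_iff)
  have "perturbed_cmatrix Q bs ev q = matrix_inv Q ** J ** Q + matrix_inv Q ** S ** Q"
    unfolding perturbed_cmatrix_def shifted
    by (simp add: matrix_matrix_mult_def Finite_Cartesian_Product.vec_eq_iff sum.distrib algebra_simps)
  moreover from this have "cm (perturbed_cmatrix Q bs ev q) = R ** cm J ** C + R ** S ** C"
    by (simp add: cm_add cm_mult cmS C_def R_def)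
  ultimately have "cm (perturbed_cmatrix Q bs ev q) = perturbed_cmatrix Q bs ev q"
    by (simp add: eqM eqS)
  then have "cnj (perturbed_cmatrix Q bs ev q $ i $ j) = perturbed_cmatrix Q bs ev q $ i $ j" for i j
    unfolding cm_def by (metis nth_map_matrix)
  then have "perturbed_cmatrix Q bs ev q $ i $ j \<in> \<real>" for i j
    by (simp add: Reals_cnj_iff)
  then show ?thesis
    unfolding perturbed_matrix_def by (simp add: Finite_Cartesian_Product.vec_eq_iff of_real_Re)
qed

definition perturbed_ocp ::
  "('nx::finite, 'nu::finite, 'ng::finite) ocp \<Rightarrow> complex^'nx^'nx \<Rightarrow> (nat \<times> complex) list \<Rightarrow>
    ('d::finite \<Rightarrow> complex) \<Rightarrow> real^'d \<Rightarrow> ('nx, 'nu, 'ng) ocp" where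
  "perturbed_ocp P Q bs ev q = P\<lparr>sysA := perturbed_matrix Q bs ev q\<rparr>"

definition violations :: "('nx::finite, 'nu::finite, 'ng::finite) ocp \<Rightarrow> (nat \<Rightarrow> real^'nu) \<Rightarrow> nat set" where
  "violations P u = {i\<in>{1..num_pts P}. \<not> (rho_min P \<le> gfun P (u i) \<and> gfun P (u i) \<le> rho_max P)}"

definition cube :: "real \<Rightarrow> (real^'d::finite) set" where
  "cube \<epsilon> = {q. \<forall>i. - \<epsilon> \<le> q $ i \<and> q $ i \<le> \<epsilon>}"

end

theory Submission
  imports Defs
begin

text \<open>No multipliers are needed. Suppose the optimal trajectory of (P8) violates the constraint at
  \<open>n\<^sub>x\<close> grid points \<open>i\<close>. There \<open>g(u\<^sub>i) < \<rho>\<^sub>m\<^sub>i\<^sub>n\<close>, so \<open>u\<^sub>i\<close> can be varied freely. If the blocks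
  \<open>A^(N-i) B\<close> for these \<open>i\<close> jointly have rank \<open>n\<^sub>x\<close>, such variations steer the terminal state in any
  direction, and convexity forces every \<open>\<sigma>\<^sub>i\<close> to be \<open>\<rho>\<^sub>m\<^sub>i\<^sub>n\<close> and \<open>x\<^sub>N\<^sub>+\<^sub>1\<close> to minimize (P7). By
  compactness of the set of controls, normality of (P4) excludes this for all small \<open>q\<close>.

  The rank condition fails only on a null set of small \<open>q\<close>: moving \<open>q\<close> along the diagonal
  \<open>(1, \<dots>, 1)\<close> adds a multiple of the identity to the system matrix, so along every diagonal line
  the Gram determinant of the blocks is a univariate polynomial. It is not the zero polynomial, by
  controllability and an asymptotic argument, so it has finitely many zeros, and
  Fubini's theorem applies.\<close>

section \<open>Gram matrices of blocks\<close>

text \<open>The rank of the concatenated blocks \<open>F i\<close> is encoded by one determinant: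
  the concatenation has full row rank iff its Gram matrix is nonsingular. Unlike a rank, the
  determinant is continuous and polynomial in the entries.\<close>

definition gram :: "'i set \<Rightarrow> ('i \<Rightarrow> real^'u^'n) \<Rightarrow> real^'n^'n" where
  "gram I F = (\<Sum>i\<in>I. F i ** Finite_Cartesian_Product.transpose (F i))"

lemma sum_matrix_vector_mult: "(\<Sum>i\<in>I. F i) *v w = (\<Sum>i\<in>I. F i *v (w::real^'n))"
  by (induction I rule: infinite_finite_induct) (auto simp: matrix_vector_mult_add_rdistrib)

lemma gram_mult: "gram I F *v w = (\<Sum>i\<in>I. F i *v (w v* F i))"
  unfolding gram_def sum_matrix_vector_mult
  by (simp add: matrix_vector_mul_assoc[symmetric] transpose_matrix_vector)

text \<open>The quadratic form of the Gram matrix at \<open>w\<close> is the sum of the squared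
  norms of the rows \<open>w v* F i\<close>, so it vanishes only if each of them does.\<close>

lemma gram_mult_eq_0_iff:
  assumes "finite I"
  shows "gram I F *v w = 0 \<longleftrightarrow> (\<forall>i\<in>I. w v* F i = 0)"
proof
  assume "gram I F *v w = 0"
  then have "0 = w \<bullet> (gram I F *v w)" by simp
  also have "\<dots> = (\<Sum>i\<in>I. (w v* F i) \<bullet> (w v* F i))"
    unfolding gram_mult inner_sum_right by (simp add: dot_lmul_matrix)
  finally show "\<forall>i\<in>I. w v* F i = 0"
    using assms sum_nonneg_eq_0_iff[of I "\<lambda>i. (w v* F i) \<bullet> (w v* F i)"] by simp
qed (simp add: gram_mult)

lemma det_nonzero_iff_ker:
  "Determinants.det (M::real^'n^'n) \<noteq> 0 \<longleftrightarrow> (\<forall>w. M *v w = 0 \<longrightarrow> w = 0)"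
  unfolding invertible_det_nz[symmetric] invertible_left_inverse matrix_left_invertible_ker ..

lemma det_gram_nonzero_iff:
  assumes "finite I"
  shows "Determinants.det (gram I F) \<noteq> 0 \<longleftrightarrow> (\<forall>w. (\<forall>i\<in>I. w v* F i = 0) \<longrightarrow> w = 0)"
  unfolding det_nonzero_iff_ker gram_mult_eq_0_iff[OF assms] ..

text \<open>With \<open>W\<close> inverse to the Gram matrix, the transposes of the blocks applied
  to \<open>W *v y\<close> give an explicit preimage of \<open>y\<close>.\<close>

lemma det_gram_nonzero_surj:
  assumes "Determinants.det (gram I F) \<noteq> 0"
  obtains v where "(\<Sum>i\<in>I. F i *v v i) = y"
proof -
  obtain W where "gram I F ** W = Finite_Cartesian_Product.mat 1"
    using assms unfolding invertible_det_nz[symmetric] invertible_def by blast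
  then have "gram I F *v (W *v y) = y"
    by (simp add: matrix_vector_mul_assoc)
  then show ?thesis using that[of "\<lambda>i. (W *v y) v* F i"] by (simp add: gram_mult)
qed

lemma continuous_on_matrix_mult [continuous_intros]:
  assumes "continuous_on S (f :: 'a::topological_space \<Rightarrow> 'b::real_normed_algebra_1^'m^'n)"
    "continuous_on S g"
  shows "continuous_on S (\<lambda>x. f x ** (g x :: 'b^'k^'m))"
  unfolding matrix_matrix_mult_def using assms by (intro continuous_intros)

lemma continuous_on_gram:
  assumes "\<And>i. i \<in> I \<Longrightarrow> continuous_on S (F i)"
  shows "continuous_on S (\<lambda>x. gram I (\<lambda>i. F i x))"
  unfolding gram_def Finite_Cartesian_Product.transpose_def using assms
  by (intro continuous_intros)

lemma continuous_on_mat_pow [continuous_intros]: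
  assumes "continuous_on S (f :: 'a::topological_space \<Rightarrow> real^'n^'n)"
  shows "continuous_on S (\<lambda>x. mat_pow (f x) k)"
  unfolding mat_pow_def by (induction k) (use assms in \<open>auto intro!: continuous_intros\<close>)

lemma continuous_on_det [continuous_intros]:
  assumes "continuous_on S (f :: 'a::topological_space \<Rightarrow> real^'n^'n)"
  shows "continuous_on S (\<lambda>x. Determinants.det (f x))"
  unfolding Determinants.det_def using assms by (intro continuous_intros)

text \<open>The exponents form an arbitrary set: \<open>{..<CARD('n)}\<close> encodes
  controllability, other sets describe what can be reached by varying the controls at selected grid
  points only.\<close>

definition ctrl_gram :: "nat set \<Rightarrow> real^'n^'n \<Rightarrow> real^'u^'n \<Rightarrow> real^'n^'n" where
  "ctrl_gram S M B = gram S (\<lambda>k. mat_pow M k ** B)"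

lemma mat_pow_0: "mat_pow M 0 = Finite_Cartesian_Product.mat 1"
  and mat_pow_Suc: "mat_pow M (Suc k) = M ** mat_pow M k"
  by (simp_all add: mat_pow_def)

lemma continuous_on_ctrl_gram:
  assumes "continuous_on S f"
  shows "continuous_on S (\<lambda>x. Determinants.det (ctrl_gram I (f x) B))"
  unfolding ctrl_gram_def
  by (intro continuous_on_det continuous_on_gram continuous_intros assms)

text \<open>A row vector that annihilates all blocks annihilates every column of the controllability
  matrix, and the transpose of that matrix is injective because it has full rank.\<close>

lemma controllable_imp_ctrl_gram_nonzero:
  fixes M :: "real^'n^'n" and B :: "real^'u^'n"
  assumes "controllable M B"
  shows "Determinants.det (ctrl_gram {..<CARD('n)} M B) \<noteq> 0"
  unfolding ctrl_gram_def
proof (subst det_gram_nonzero_iff, simp, intro allI impI)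
  fix w :: "real^'n"
  assume *: "\<forall>k\<in>{..<CARD('n)}. w v* (mat_pow M k ** B) = 0"
  have "w v* ctrb_matrix M B = 0"
    unfolding Finite_Cartesian_Product.vec_eq_iff
  proof
    fix jk :: "'n \<times> 'u"
    have "ix (fst jk) < CARD('n)" using bij_betw_ix[where 'n='n] unfolding bij_betw_def by blast
    then have "w v* (mat_pow M (ix (fst jk)) ** B) = 0" using * by blast
    then have "(w v* (mat_pow M (ix (fst jk)) ** B)) $ snd jk = 0" by simp
    then show "(w v* ctrb_matrix M B) $ jk = 0 $ jk"
      by (simp add: vector_matrix_mult_def ctrb_matrix_def)
  qed
  moreover have "inj ((*v) (Finite_Cartesian_Product.transpose (ctrb_matrix M B)))"
    unfolding full_rank_injective[symmetric] rank_transpose using assms by (simp add: controllable_def)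
  ultimately show "w = 0"
    by (metis injD matrix_vector_mult_0_right transpose_matrix_vector)
qed

section \<open>Polynomial functions: determinants and roots\<close>

lemma real_polynomial_function_det:
  assumes "\<And>i j. real_polynomial_function (\<lambda>x. f x $ i $ j)"
  shows "real_polynomial_function (\<lambda>x. Determinants.det (f x :: real^'n^'n))"
  unfolding Determinants.det_def using assms
  by (intro real_polynomial_function_sum real_polynomial_function.intros(4)
      real_polynomial_function.intros(2) real_polynomial_function_prod)
    (auto simp: finite_permutations)

lemma finite_roots_real_polynomial_function:
  fixes f :: "real \<Rightarrow> real"
  assumes "real_polynomial_function f" "f t \<noteq> 0"
  shows "finite {t. f t = 0}"
proof -
  obtain a n where f: "f = (\<lambda>x. \<Sum>i\<le>n. a i * x ^ i)"
    using assms(1) unfolding real_polynomial_function_iff_sum by blast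
  have "\<exists>k\<le>n. a k \<noteq> 0" using assms(2) unfolding f
    by (metis (no_types, lifting) atMost_iff mult_zero_left sum.neutral)
  then show ?thesis unfolding f polyfun_finite_roots by blast
qed

section \<open>Shifting a controllable matrix by a multiple of the identity\<close>

text \<open>The matrix with entries \<open>k choose ix j\<close> for \<open>k < CARD('n)\<close> is
  unitriangular, so the coefficients vanish one after another by strong induction on the
  index.\<close>

lemma sum_choose_zero_imp_zero:
  fixes a :: "real^'n"
  assumes "\<And>k. (\<Sum>j\<in>UNIV. a $ j * real (k choose ix j)) = 0"
  shows "a = 0"
proof -
  have inj: "inj (ix :: 'n \<Rightarrow> nat)" using bij_betw_ix unfolding bij_betw_def by blast
  have "a $ j = 0" for j
  proof (induction "ix j" arbitrary: j rule: less_induct)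
    case less
    have "0 = (\<Sum>i\<in>UNIV. a $ i * real (ix j choose ix i))" using assms by simp
    also have "\<dots> = (\<Sum>i\<in>UNIV. if i = j then a $ j else 0)"
    proof (rule sum.cong[OF refl])
      fix i
      show "a $ i * real (ix j choose ix i) = (if i = j then a $ j else 0)"
      proof (cases "ix i" "ix j" rule: linorder_cases)
        case less': less
        then show ?thesis using less by auto
      qed (use inj in \<open>auto dest: injD\<close>)
    qed
    finally show "a $ j = 0" by simp
  qed
  then show ?thesis by (simp add: Finite_Cartesian_Product.vec_eq_iff)
qed

text \<open>A Vandermonde argument in the basis of binomial polynomials: a kernel vector gives a
  polynomial of degree below \<open>CARD('n)\<close> with the \<open>CARD('n)\<close> distinct roots
  \<open>e i\<close>, hence the zero polynomial.\<close>

lemma det_choose_nonzero: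
  fixes e :: "'n::finite \<Rightarrow> nat"
  assumes "inj e"
  shows "Determinants.det (\<chi> i j. real (e i choose ix (j::'n)) :: real^'n^'n) \<noteq> 0"
  unfolding det_nonzero_iff_ker
proof (intro allI impI)
  fix a :: "real^'n"
  \<comment> \<open>\<open>r m\<close> is the falling factorial, that is \<open>fact m\<close> times
    the binomial polynomial of degree \<open>m\<close>.\<close>
  define r where "r m = (\<Prod>i<m. [:- of_nat i, 1::real:])" for m :: nat
  define p where "p = (\<Sum>j\<in>UNIV. Polynomial.smult (a $ j / fact (ix j)) (r (ix j)))"
  have val: "poly p (real k) = (\<Sum>j\<in>UNIV. a $ j * real (k choose ix j))" for k
    unfolding p_def r_def binomial_gbinomial gbinomial_prod_rev
    by (simp add: poly_sum poly_prod atLeast0LessThan of_nat_prod)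
  assume "(\<chi> i j. real (e i choose ix j)) *v a = 0"
  then have "(\<Sum>j\<in>UNIV. real (e i choose ix j) * a $ j) = 0" for i
    by (simp add: matrix_vector_mult_def Finite_Cartesian_Product.vec_eq_iff)
  then have roots: "(\<lambda>i. real (e i)) ` UNIV \<subseteq> {x. poly p x = 0}"
    by (auto simp: val mult.commute)
  have "degree (r m) \<le> m" for m
    unfolding r_def by (rule order_trans[OF degree_prod_sum_le]) auto
  moreover have ixlt: "ix (j::'n) < CARD('n)" for j
    using bij_betw_ix[where 'n='n] unfolding bij_betw_def by blast
  ultimately have "degree (Polynomial.smult (a $ j / fact (ix j)) (r (ix j))) \<le> CARD('n) - 1" for j
    by (metis (no_types, lifting) Suc_leI Suc_pred' degree_smult_le le_trans not_less_eq_eq zero_less_card_finite)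
  then have "degree p \<le> CARD('n) - 1"
    unfolding p_def by (intro degree_sum_le) auto
  moreover have "CARD('n) = card ((\<lambda>i. real (e i)) ` UNIV)"
    using assms by (subst card_image) (auto simp: inj_def)
  moreover have "card ((\<lambda>i. real (e i)) ` UNIV) \<le> degree p" if "p \<noteq> 0"
    using card_mono[OF poly_roots_finite[OF that] roots] card_poly_roots_bound[OF that] by linarith
  moreover have "CARD('n) > 0" by simp
  ultimately have "p = 0" by linarith
  then show "a = 0" by (intro sum_choose_zero_imp_zero) (simp flip: val)
qed

lemma scaleR_matrix_mult:
  fixes X :: "real^'m^'n" and Y :: "real^'k^'m"
  shows "(c *\<^sub>R X) ** Y = c *\<^sub>R (X ** Y)" "X ** (c *\<^sub>R Y) = c *\<^sub>R (X ** Y)"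
  by (simp_all add: matrix_matrix_mult_def Finite_Cartesian_Product.vec_eq_iff sum_distrib_left mult_ac)

lemma matrix_add_rdistrib:
  fixes X Y :: "real^'m^'n"
  shows "(X + Y) ** Z = X ** Z + Y ** Z"
  by (simp add: matrix_matrix_mult_def Finite_Cartesian_Product.vec_eq_iff sum.distrib distrib_right)

lemma sum_matrix_mult_right:
  fixes X :: "real^'m^'n"
  shows "X ** (\<Sum>i\<in>I. F i) = (\<Sum>i\<in>I. X ** F i)"
  by (induction I rule: infinite_finite_induct) (auto simp: matrix_add_ldistrib)

lemma mat_pow_scaleR: "mat_pow (c *\<^sub>R (X::real^'n^'n)) k = c ^ k *\<^sub>R mat_pow X k"
  by (induction k) (simp_all add: mat_pow_0 mat_pow_Suc scaleR_matrix_mult mult_ac)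

text \<open>The binomial theorem, proved by Pascal's rule. The summation bound \<open>D\<close> is
  independent of \<open>k\<close>, the surplus coefficients being 0, so that expansions for
  different exponents can be combined termwise.\<close>

lemma mat_pow_one_plus:
  fixes M :: "real^'n^'n"
  assumes "k < D"
  shows "mat_pow (Finite_Cartesian_Product.mat 1 + \<epsilon> *\<^sub>R M) k
    = (\<Sum>m<D. (real (k choose m) * \<epsilon> ^ m) *\<^sub>R mat_pow M m)"
  using assms
proof (induction k)
  case 0
  then show ?case by (subst sum.remove[of _ 0]) (auto simp: mat_pow_0 binomial_eq_0 intro!: sum.neutral)
next
  case (Suc k)
  let ?t = "\<lambda>k m. (real (k choose m) * \<epsilon> ^ m) *\<^sub>R mat_pow M m"
  obtain D' where D: "D = Suc D'" using Suc.prems by (cases D) auto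
  have "mat_pow (Finite_Cartesian_Product.mat 1 + \<epsilon> *\<^sub>R M) (Suc k)
      = (\<Sum>m<D. ?t k m) + (\<Sum>m<D. (real (k choose m) * \<epsilon> ^ Suc m) *\<^sub>R mat_pow M (Suc m))"
    using Suc by (simp add: mat_pow_Suc matrix_add_rdistrib scaleR_matrix_mult sum_matrix_mult_right
        scaleR_add_right sum.distrib mult_ac)
  also have "(\<Sum>m<D. (real (k choose m) * \<epsilon> ^ Suc m) *\<^sub>R mat_pow M (Suc m))
      = (\<Sum>m<D'. (real (k choose m) * \<epsilon> ^ Suc m) *\<^sub>R mat_pow M (Suc m))"
    using Suc.prems by (simp add: D binomial_eq_0)
  also have "(\<Sum>m<D. ?t k m) = ?t k 0 + (\<Sum>m<D'. ?t k (Suc m))"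
    by (simp only: D sum.lessThan_Suc_shift)
  also have "?t k 0 + (\<Sum>m<D'. ?t k (Suc m))
      + (\<Sum>m<D'. (real (k choose m) * \<epsilon> ^ Suc m) *\<^sub>R mat_pow M (Suc m))
      = ?t (Suc k) 0 + (\<Sum>m<D'. ?t (Suc k) (Suc m))"
    by (simp add: sum.distrib[symmetric] scaleR_add_left[symmetric] distrib_right add_ac)
  also have "\<dots> = (\<Sum>m<D. ?t (Suc k) m)"
    by (simp only: D sum.lessThan_Suc_shift)
  finally show ?case .
qed

lemma linear_row_times: "linear (\<lambda>X. (w::real^'n) v* (X ** (B::real^'u^'m)) :: real^'u)"
  by (rule linearI)
    (simp_all add: vector_matrix_mult_def matrix_matrix_mult_def Finite_Cartesian_Product.vec_eq_iff
      sum_distrib_left sum_distrib_right sum.distrib algebra_simps)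

text \<open>Put \<open>t = 1/\<epsilon>\<close>. Since \<open>(1 + \<epsilon> M)^k\<close> expands with coefficients \<open>k choose m\<close>, which form a
  nonsingular matrix for \<open>k \<in> S\<close> and \<open>m < CARD('n)\<close>, some combination of these powers equals
  \<open>\<epsilon>^j (M^j + O(\<epsilon>))\<close> for every \<open>j < CARD('n)\<close>; so for small \<open>\<epsilon>\<close> controllability carries over.\<close>

lemma ctrl_gram_shift_nonzero:
  fixes M :: "real^'n^'n" and B :: "real^'u^'n"
  assumes M: "Determinants.det (ctrl_gram {..<CARD('n)} M B) \<noteq> 0"
    and S: "finite S" "card S = CARD('n)"
  shows "\<exists>t. Determinants.det (ctrl_gram S (M + t *\<^sub>R Finite_Cartesian_Product.mat 1) B) \<noteq> 0"
proof -
  let ?I = "Finite_Cartesian_Product.mat 1 :: real^'n^'n"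
  obtain e :: "'n \<Rightarrow> nat" where e: "bij_betw e UNIV S"
    using S finite_same_card_bij[of "UNIV :: 'n set" S] by auto
  then have inj_e: "inj e" and e_S: "range e = S" by (auto simp: bij_betw_def)
  have ix: "inj (ix :: 'n \<Rightarrow> nat)" "range (ix :: 'n \<Rightarrow> nat) = {..<CARD('n)}"
    using bij_betw_ix[where 'n='n] by (auto simp: bij_betw_def)
  define V :: "real^'n^'n" where "V = (\<chi> i j. real (e i choose ix j))"
  obtain W where WV: "W ** V = ?I"
    using det_choose_nonzero[OF inj_e] unfolding V_def[symmetric] invertible_det_nz[symmetric] invertible_def
    by blast
  \<comment> \<open>Coefficient of \<open>\<epsilon> ^ m *\<^sub>R mat_pow M m\<close> after the
    expanded powers are combined with row \<open>j\<close> of \<open>W\<close>. It is 0 for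
    \<open>m < ix j\<close> and 1 for \<open>m = ix j\<close>.\<close>
  define d where "d j m = (\<Sum>i\<in>UNIV. W $ j $ i * real (e i choose m))" for j m
  have d_ix: "d j (ix m) = (if m = j then 1 else 0)" for j m
    using arg_cong[OF WV, of "\<lambda>X. X $ j $ m"]
    by (simp add: d_def V_def matrix_matrix_mult_def Finite_Cartesian_Product.mat_def)
  have d_less: "d j m = 0" if "m < ix j" for j m
  proof -
    have "ix j < CARD('n)" using ix(2) by blast
    then have "m \<in> range (ix :: 'n \<Rightarrow> nat)" using that by (simp add: ix(2))
    then obtain m' :: 'n where "m = ix m'" by blast
    then show ?thesis using that d_ix[of j m'] by auto
  qed
  \<comment> \<open>Exceeds all exponents in \<open>S\<close> and all values of \<open>ix\<close>,
    so a single summation range serves every expansion.\<close>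
  define D where "D = Suc (Max (S \<union> {..<CARD('n)}))"
  have D: "m < D" if "m \<in> S \<union> {..<CARD('n)}" for m
    unfolding D_def using that S by (simp add: less_Suc_eq_le)
  have ixD: "ix (j::'n) < D" for j using D ix(2) by blast
  \<comment> \<open>The combination divided by \<open>\<epsilon> ^ ix j\<close>, which stays
    meaningful at \<epsilon> = 0. Truncation in \<open>m - ix j\<close> is harmless since
    \<open>d j m\<close> is 0 there.\<close>
  define R where "R j \<epsilon> = (\<Sum>m<D. (d j m * \<epsilon> ^ (m - ix j)) *\<^sub>R mat_pow M m)" for j \<epsilon>
  have R: "\<epsilon> ^ ix j *\<^sub>R R j \<epsilon> = (\<Sum>i\<in>UNIV. W $ j $ i *\<^sub>R mat_pow (?I + \<epsilon> *\<^sub>R M) (e i))" for j \<epsilon>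
  proof -
    have "(\<Sum>i\<in>UNIV. W $ j $ i *\<^sub>R mat_pow (?I + \<epsilon> *\<^sub>R M) (e i))
        = (\<Sum>i\<in>UNIV. W $ j $ i *\<^sub>R (\<Sum>m<D. (real (e i choose m) * \<epsilon> ^ m) *\<^sub>R mat_pow M m))"
      using D e_S by (intro sum.cong refl arg_cong2[of _ _ _ _ scaleR] mat_pow_one_plus) auto
    also have "\<dots> = (\<Sum>m<D. (d j m * \<epsilon> ^ m) *\<^sub>R mat_pow M m)"
      unfolding d_def scaleR_sum_right
      by (subst sum.swap) (simp add: sum_distrib_left scaleR_sum_left mult_ac)
    also have "\<dots> = \<epsilon> ^ ix j *\<^sub>R R j \<epsilon>"
      unfolding R_def scaleR_sum_right
    proof (rule sum.cong[OF refl])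
      fix m
      show "(d j m * \<epsilon> ^ m) *\<^sub>R mat_pow M m
          = \<epsilon> ^ ix j *\<^sub>R (d j m * \<epsilon> ^ (m - ix j)) *\<^sub>R mat_pow M m"
        using d_less[of m j] by (cases "m < ix j") (auto simp: power_add[symmetric] mult.left_commute)
    qed
    finally show ?thesis by simp
  qed
  have R0: "R j 0 = mat_pow M (ix j)" for j
  proof -
    have "R j 0 = (\<Sum>m<D. if m = ix j then mat_pow M (ix j) else 0)"
      unfolding R_def
    proof (rule sum.cong[OF refl])
      fix m
      show "(d j m * 0 ^ (m - ix j)) *\<^sub>R mat_pow M m = (if m = ix j then mat_pow M (ix j) else 0)"
        using d_less[of m j] d_ix[of j j] by (cases m "ix j" rule: linorder_cases) auto
    qed
    then show ?thesis using ixD by simp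
  qed
  \<comment> \<open>At \<epsilon> = 0 this tests exactly the blocks of the controllability
    condition; by continuity it stays nonzero for some \<epsilon> > 0.\<close>
  define G where "G \<epsilon> = Determinants.det (gram UNIV (\<lambda>j. R j \<epsilon> ** B))" for \<epsilon>
  have "\<forall>w. (\<forall>k\<in>range (ix :: 'n \<Rightarrow> nat). w v* (mat_pow M k ** B) = 0) \<longrightarrow> w = 0"
    using M unfolding ctrl_gram_def ix(2) det_gram_nonzero_iff[OF finite_lessThan] .
  then have G0: "G 0 \<noteq> 0"
    unfolding G_def R0 det_gram_nonzero_iff[OF finite] by blast
  have "continuous_on UNIV G"
    unfolding G_def R_def by (intro continuous_on_det continuous_on_gram continuous_intros)
  then have "open {\<epsilon>. G \<epsilon> \<noteq> 0}"
    by (intro open_Collect_neq continuous_intros)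
  then obtain \<delta> where \<delta>: "\<delta> > 0" "ball 0 \<delta> \<subseteq> {\<epsilon>. G \<epsilon> \<noteq> 0}"
    using G0 by (auto simp: open_contains_ball)
  define \<epsilon> where "\<epsilon> = \<delta> / 2"
  have \<epsilon>: "\<epsilon> > 0" "G \<epsilon> \<noteq> 0"
    using \<delta> by (auto simp: \<epsilon>_def subset_iff)
  have "w = 0" if w: "\<And>k. k \<in> S \<Longrightarrow> w v* (mat_pow (M + (1/\<epsilon>) *\<^sub>R ?I) k ** B) = 0" for w
  proof -
    define L where "L X = w v* (X ** B)" for X
    have L: "linear L" unfolding L_def by (rule linear_row_times)
    \<comment> \<open>Up to the factor \<epsilon>, the expanded matrix is the matrix shifted by
      1/\<epsilon>, so both have the same annihilated powers.\<close>
    have "?I + \<epsilon> *\<^sub>R M = \<epsilon> *\<^sub>R (M + (1/\<epsilon>) *\<^sub>R ?I)" using \<epsilon> by (simp add: algebra_simps)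
    then have "L (mat_pow (?I + \<epsilon> *\<^sub>R M) k) = 0" if "k \<in> S" for k
      using w[OF that] linear_scale[OF L] by (simp add: mat_pow_scaleR L_def[symmetric])
    then have "L (\<epsilon> ^ ix j *\<^sub>R R j \<epsilon>) = 0" for j
      unfolding R using e_S by (auto simp: linear_sum[OF L] linear_scale[OF L] intro!: sum.neutral)
    then have "L (R j \<epsilon>) = 0" for j using \<epsilon>(1) by (simp add: linear_scale[OF L])
    then show ?thesis
      using \<epsilon>(2) unfolding G_def L_def det_gram_nonzero_iff[OF finite] by blast
  qed
  then show ?thesis unfolding ctrl_gram_def
    unfolding det_gram_nonzero_iff[OF S(1)] by blast
qed

lemma real_polynomial_function_ctrl_gram_shift:
  fixes M :: "real^'n^'n" and B :: "real^'u^'n"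
  shows "real_polynomial_function
    (\<lambda>t. Determinants.det (ctrl_gram S (M + t *\<^sub>R Finite_Cartesian_Product.mat 1) B))"
proof (rule real_polynomial_function_det)
  let ?M = "\<lambda>t. M + t *\<^sub>R Finite_Cartesian_Product.mat 1"
  have idr: "real_polynomial_function (\<lambda>t::real. t)"
    by (rule real_polynomial_function.intros(1)) (rule bounded_linear_ident)
  note pf = real_polynomial_function.intros(4) real_polynomial_function.intros(2)
    real_polynomial_function.intros(3) idr
  have mul: "real_polynomial_function (\<lambda>t. (F t ** G t) $ i $ j)"
    if "\<And>i j. real_polynomial_function (\<lambda>t. F t $ i $ j)" "\<And>i j. real_polynomial_function (\<lambda>t. G t $ i $ j)"
    for F :: "real \<Rightarrow> real^'a::finite^'b::finite" and G :: "real \<Rightarrow> real^'c::finite^'a" and i j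
    unfolding matrix_matrix_mult_def using that
    by (simp, intro real_polynomial_function_sum pf) auto
  have shift: "real_polynomial_function (\<lambda>t. ?M t $ i $ j)" for i j
    by (simp, intro pf)
  have pow: "real_polynomial_function (\<lambda>t. mat_pow (?M t) k $ i $ j)" for k i j
  proof (induction k arbitrary: i j)
    case 0
    show ?case unfolding mat_pow_0 by (rule pf(2))
  next
    case (Suc k)
    then show ?case unfolding mat_pow_Suc by (intro mul shift)
  qed
  have MB: "real_polynomial_function (\<lambda>t. (mat_pow (?M t) k ** B) $ i $ j)" for k i j
    by (intro mul pow pf(2))
  show "real_polynomial_function (\<lambda>t. ctrl_gram S (?M t) B $ i $ j)" for i j
  proof (cases "finite S")
    case True
    have "real_polynomial_function (\<lambda>t. \<Sum>k\<in>S. ((mat_pow (?M t) k ** B) **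
        Finite_Cartesian_Product.transpose (mat_pow (?M t) k ** B)) $ i $ j)"
      by (rule real_polynomial_function_sum[OF True], rule mul)
        (simp_all add: MB Finite_Cartesian_Product.transpose_def)
    then show ?thesis by (simp add: ctrl_gram_def gram_def sum_component)
  \<comment> \<open>A sum over an infinite index set is 0 by convention, hence constant in
    \<open>t\<close>.\<close>
  qed (auto simp: ctrl_gram_def gram_def intro: pf(2))
qed

section \<open>Generic perturbations\<close>

text \<open>By translation invariance, averaging the measures of the translates of \<open>Z\<close>
  along \<open>e\<close> over times in [0,1] returns the measure of \<open>Z\<close>. After
  exchanging the integrals, the inner one runs along a line that meets \<open>Z\<close> in a
  countable set and is 0.\<close>

lemma null_set_countable_on_lines:
  fixes Z :: "'a::euclidean_space set"
  assumes Z[measurable]: "Z \<in> sets borel" and lines: "\<And>x. countable {t::real. x + t *\<^sub>R e \<in> Z}"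
  shows "Z \<in> null_sets lborel"
proof -
  let ?f = "\<lambda>(t::real) x. indicator {0..1} t * indicator Z (t *\<^sub>R e + x) :: ennreal"
  have "emeasure lborel Z = (\<integral>\<^sup>+ t. indicator {0..1::real} t * emeasure lborel Z \<partial>lborel)"
    by (simp add: nn_integral_multc)
  also have "\<dots> = (\<integral>\<^sup>+ t. (\<integral>\<^sup>+ x. ?f t x \<partial>lborel) \<partial>lborel)"
  proof (rule nn_integral_cong)
    fix t :: real
    have "(\<integral>\<^sup>+ x. indicator Z (t *\<^sub>R e + x) \<partial>lborel)
        = (\<integral>\<^sup>+ x. indicator Z x \<partial>distr lborel borel ((+) (t *\<^sub>R e)))"
      by (subst nn_integral_distr) auto
    also have "\<dots> = emeasure lborel Z" by (simp add: lborel_distr_plus)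
    finally have "(\<integral>\<^sup>+ x. indicator Z (t *\<^sub>R e + x) \<partial>lborel) = emeasure lborel Z" .
    then show "indicator {0..1} t * emeasure lborel Z = (\<integral>\<^sup>+ x. ?f t x \<partial>lborel)"
      by (subst nn_integral_cmult) auto
  qed
  also have "\<dots> = (\<integral>\<^sup>+ x. (\<integral>\<^sup>+ t. ?f t x \<partial>lborel) \<partial>lborel)"
    by (rule pair_sigma_finite.Fubini'[symmetric])
      (auto intro!: pair_sigma_finite.intro lborel.sigma_finite_measure_axioms)
  also have "\<dots> = (\<integral>\<^sup>+ x. 0 \<partial>(lborel :: 'a measure))"
  proof (rule nn_integral_cong)
    fix x :: 'a
    have "AE t in lborel. t \<notin> {t::real. x + t *\<^sub>R e \<in> Z}"
      by (rule AE_not_in) (rule countable_imp_null_set_lborel[OF lines])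
    then have "(\<integral>\<^sup>+ t. ?f t x \<partial>lborel) = (\<integral>\<^sup>+ (t::real). 0 \<partial>lborel)"
      by (intro nn_integral_cong_AE) (auto simp: add.commute)
    then show "(\<integral>\<^sup>+ t. ?f t x \<partial>lborel) = 0" by simp
  qed
  finally show ?thesis by (simp add: null_sets_def)
qed

lemma cube_subset_open:
  fixes U :: "(real^'d) set"
  assumes "open U" "0 \<in> U"
  shows "\<exists>\<delta>>0. cube \<delta> \<subseteq> U"
proof -
  obtain r where r: "r > 0" "ball 0 r \<subseteq> U" using assms open_contains_ball by blast
  \<comment> \<open>Coordinates bounded by \<open>\<delta>\<close> give an l1 norm of at most
    \<open>r / 2\<close>, which dominates the Euclidean norm.\<close>
  define \<delta> where "\<delta> = r / (2 * CARD('d))"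
  have "q \<in> ball 0 r" if "q \<in> cube \<delta>" for q :: "real^'d"
  proof -
    have "norm q \<le> (\<Sum>i\<in>UNIV. \<bar>q $ i\<bar>)" by (rule norm_le_l1_cart)
    also have "\<dots> \<le> (\<Sum>i\<in>(UNIV::'d set). \<delta>)"
      using that by (intro sum_mono) (auto simp: cube_def abs_le_iff minus_le_iff)
    also have "\<dots> < r" using r by (simp add: \<delta>_def)
    finally show ?thesis by simp
  qed
  moreover have "\<delta> > 0" using r by (simp add: \<delta>_def)
  ultimately show ?thesis using r(2) by blast
qed

lemma cube_mono: "\<delta> \<le> \<epsilon> \<Longrightarrow> cube \<delta> \<subseteq> cube \<epsilon>"
  unfolding cube_def by (auto intro: order_trans le_imp_neg_le)

lemma closed_cube: "closed (cube \<epsilon> :: (real^'d) set)"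
proof -
  have "cube \<epsilon> = (\<Inter>i. {q :: real^'d. - \<epsilon> \<le> q $ i} \<inter> {q. q $ i \<le> \<epsilon>})"
    by (auto simp: cube_def)
  moreover have "closed \<dots>"
    by (intro closed_INT ballI closed_Int closed_Collect_le continuous_intros)
  ultimately show ?thesis by simp
qed

section \<open>The perturbed system matrix as a function of \<open>q\<close>\<close>

lemma jordan_cart_map_nth:
  assumes "sum_list (map fst bs) = CARD('n)"
  shows "(jordan_cart (map (\<lambda>(k, c). (k, f c)) bs) :: complex^'n^'n) $ i $ j =
    (if i = j then f ((jordan_cart bs :: complex^'n^'n) $ i $ i) else (jordan_cart bs :: complex^'n^'n) $ i $ j)"
proof -
  have "ix (i::'n) < CARD('n)" for i using bij_betw_ix[where 'n='n] unfolding bij_betw_def by blast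
  moreover have "ix (i::'n) = ix j \<longleftrightarrow> i = j" for i j
    using bij_betw_ix[where 'n='n] unfolding bij_betw_def inj_on_def by blast
  ultimately show ?thesis unfolding jordan_cart_def
    by (simp add: jordan_matrix_map_diag assms)
qed

lemma perturbed_matrix_0:
  assumes "jordan_form M Q bs"
  shows "perturbed_matrix Q bs ev 0 = M"
proof -
  have "map (\<lambda>(k, c). (k, shift_ev ev 0 c)) bs = bs"
    by (rule map_idI) (auto simp: shift_ev_def)
  then have "perturbed_cmatrix Q bs ev 0 = map_matrix complex_of_real M"
    using assms by (simp add: perturbed_cmatrix_def jordan_form_def)
  then show ?thesis
    by (simp add: perturbed_matrix_def Finite_Cartesian_Product.vec_eq_iff)
qed

text \<open>Along the all-ones vector every eigenvalue gets the same shift, including both members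
  of a conjugate pair. The Jordan matrix thus gains a multiple of the identity, which the change of
  basis leaves fixed.\<close>

lemma perturbed_matrix_shift:
  fixes M :: "real^'n^'n"
  assumes "jordan_form M Q bs"
  shows "perturbed_matrix Q bs ev (q + t *\<^sub>R 1)
    = perturbed_matrix Q bs ev q + t *\<^sub>R Finite_Cartesian_Product.mat 1"
proof -
  let ?I = "Finite_Cartesian_Product.mat 1 :: complex^'n^'n"
  let ?c = "Finite_Cartesian_Product.mat (complex_of_real t) :: complex^'n^'n"
  let ?J = "\<lambda>q. jordan_cart (map (\<lambda>(k, c). (k, shift_ev ev q c)) bs) :: complex^'n^'n"
  have "invertible Q" and sum: "sum_list (map fst bs) = CARD('n)"
    using assms by (auto simp: jordan_form_def)
  then have QQ: "matrix_inv Q ** Q = ?I"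
    using someI_ex[of "\<lambda>X. Q ** X = ?I \<and> X ** Q = ?I"] unfolding invertible_def matrix_inv_def by auto
  have "?J (q + t *\<^sub>R 1) = ?J q + ?c"
    unfolding Finite_Cartesian_Product.vec_eq_iff
    using jordan_cart_map_nth[OF sum]
    by (simp add: shift_ev_def Finite_Cartesian_Product.mat_def)
  moreover have "X ** ?c = ?c ** X" for X :: "complex^'n^'n"
    by (simp add: matrix_matrix_mult_def Finite_Cartesian_Product.mat_def
        Finite_Cartesian_Product.vec_eq_iff if_distrib[of "\<lambda>x. x * _"] if_distrib[of "\<lambda>x. _ * x"] cong: if_cong)
  moreover have "(X + Y) ** Z = X ** Z + Y ** Z" for X Y Z :: "complex^'n^'n"
    by (simp add: matrix_matrix_mult_def Finite_Cartesian_Product.vec_eq_iff sum.distrib distrib_right)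
  ultimately have "perturbed_cmatrix Q bs ev (q + t *\<^sub>R 1) = perturbed_cmatrix Q bs ev q + ?c"
    unfolding perturbed_cmatrix_def
    by (simp add: matrix_add_ldistrib QQ flip: matrix_mul_assoc)
  then show ?thesis
    by (simp add: perturbed_matrix_def Finite_Cartesian_Product.vec_eq_iff Finite_Cartesian_Product.mat_def)
qed

text \<open>Only the diagonal of the Jordan matrix depends on \<open>q\<close>, and it does so
  affinely.\<close>

lemma continuous_on_perturbed_matrix:
  fixes M :: "real^'n^'n"
  assumes "jordan_form M Q bs"
  shows "continuous_on S (perturbed_matrix Q bs ev :: real^'d \<Rightarrow> real^'n^'n)"
proof -
  have sum: "sum_list (map fst bs) = CARD('n)"
    using assms by (auto simp: jordan_form_def)
  let ?J = "\<lambda>q :: real^'d. jordan_cart (map (\<lambda>(k, c). (k, shift_ev ev q c)) bs) :: complex^'n^'n"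
  have "continuous_on S (\<lambda>q. ?J q $ i $ j)" for i j
    unfolding jordan_cart_map_nth[OF sum] shift_ev_def
    by (cases "i = j") (auto intro!: continuous_intros)
  then have "continuous_on S (\<lambda>q. \<chi> i j. ?J q $ i $ j)"
    by (intro continuous_on_vec_lambda)
  then have "continuous_on S ?J" by simp
  then have "continuous_on S (\<lambda>q. perturbed_cmatrix Q bs ev q)"
    unfolding perturbed_cmatrix_def by (intro continuous_intros)
  then show ?thesis
    unfolding perturbed_matrix_def map_matrix_def
    by (intro continuous_on_vec_lambda continuous_intros)
qed

text \<open>The radius is chosen so that the determinant for the first \<open>CARD('n)\<close>
  powers has no zero on the cube; it therefore serves all sets \<open>S\<close> at once.\<close>

lemma perturbed_reachability_generic:
  fixes M :: "real^'n^'n" and B :: "real^'u^'n"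
  assumes J: "jordan_form M Q bs" and "controllable M B"
  shows "\<exists>\<delta>>0. \<forall>S. finite S \<and> card S = CARD('n) \<longrightarrow>
    {q \<in> cube \<delta>. Determinants.det (ctrl_gram S (perturbed_matrix Q bs ev (q :: real^'d)) B) = 0} \<in> null_sets lborel"
proof -
  let ?W = "\<lambda>S q. Determinants.det (ctrl_gram S (perturbed_matrix Q bs ev q) B)"
  have cont: "continuous_on UNIV (\<lambda>q :: real^'d. ?W S q)" for S
    by (intro continuous_on_ctrl_gram continuous_on_perturbed_matrix[OF J])
  have "open {q :: real^'d. ?W {..<CARD('n)} q \<noteq> 0}"
    by (intro open_Collect_neq cont continuous_intros)
  moreover have "0 \<in> {q :: real^'d. ?W {..<CARD('n)} q \<noteq> 0}"
    using controllable_imp_ctrl_gram_nonzero[OF assms(2)] by (simp add: perturbed_matrix_0[OF J])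
  ultimately obtain \<delta> where \<delta>: "\<delta> > 0"
    "cube \<delta> \<subseteq> {q :: real^'d. ?W {..<CARD('n)} q \<noteq> 0}"
    using cube_subset_open by metis
  have "{q \<in> cube \<delta>. ?W S (q :: real^'d) = 0} \<in> null_sets lborel"
    if S: "finite S" "card S = CARD('n)" for S
  proof (rule null_set_countable_on_lines)
    have "closed (cube \<delta> \<inter> {q :: real^'d. ?W S q = 0})"
      by (intro closed_Int closed_cube closed_Collect_eq cont continuous_intros)
    then show "{q \<in> cube \<delta>. ?W S (q :: real^'d) = 0} \<in> sets borel"
      by (simp add: Collect_conj_eq)
  next
    fix x :: "real^'d"
    show "countable {t. x + t *\<^sub>R 1 \<in> {q \<in> cube \<delta>. ?W S q = 0}}"
    proof (cases "\<exists>t. x + t *\<^sub>R 1 \<in> cube \<delta>")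
      case True
      \<comment> \<open>A point of the cube on the line serves as base point for
        \<open>ctrl_gram_shift_nonzero\<close>, which makes the polynomial along the whole line
        nonzero. A line that misses the cube contributes the empty set.\<close>
      then obtain t0 where "x + t0 *\<^sub>R 1 \<in> cube \<delta>" by blast
      then have "?W {..<CARD('n)} (x + t0 *\<^sub>R 1) \<noteq> 0" using \<delta>(2) by blast
      from ctrl_gram_shift_nonzero[OF this S] obtain t where t:
        "?W S ((x + t0 *\<^sub>R 1) + t *\<^sub>R 1) \<noteq> 0"
        unfolding perturbed_matrix_shift[OF J] by blast
      have "real_polynomial_function (\<lambda>t. ?W S (x + t *\<^sub>R 1))"
        unfolding perturbed_matrix_shift[OF J] by (rule real_polynomial_function_ctrl_gram_shift)
      moreover have "?W S (x + (t0 + t) *\<^sub>R 1) \<noteq> 0"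
        using t by (simp add: scaleR_add_left add.assoc)
      ultimately have "finite {t. ?W S (x + t *\<^sub>R 1) = 0}"
        by (rule finite_roots_real_polynomial_function)
      then show ?thesis
        by (intro countable_finite) (auto elim: rev_finite_subset)
    qed simp
  qed
  then show ?thesis using \<delta>(1) by blast
qed

section \<open>Optimal trajectories\<close>

text \<open>The dynamics are solved explicitly, so that trajectories can be handled through their
  controls alone. The control at grid point \<open>i\<close> acts on the terminal state through the
  power \<open>N - i\<close>.\<close>

definition end_state :: "real^'n^'n \<Rightarrow> real^'u^'n \<Rightarrow> real^'n \<Rightarrow> nat \<Rightarrow> (nat \<Rightarrow> real^'u) \<Rightarrow> real^'n" where
  "end_state M B y N u = mat_pow M N *v y + (\<Sum>i = 1..N. (mat_pow M (N - i) ** B) *v u i)"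

lemma end_state_0: "end_state M B y 0 u = y"
  by (simp add: end_state_def mat_pow_0)

lemma end_state_Suc: "end_state M B y (Suc N) u = M *v end_state M B y N u + B *v u (Suc N)"
proof -
  have "(\<Sum>i = 1..N. (mat_pow M (Suc N - i) ** B) *v u i)
      = (\<Sum>i = 1..N. M *v ((mat_pow M (N - i) ** B) *v u i))"
    by (rule sum.cong) (auto simp: Suc_diff_le mat_pow_Suc matrix_vector_mul_assoc matrix_mul_assoc)
  also have "\<dots> = M *v (\<Sum>i = 1..N. (mat_pow M (N - i) ** B) *v u i)"
    by (simp add: linear_sum)
  finally show ?thesis
    by (simp add: end_state_def mat_pow_0 mat_pow_Suc matrix_vector_right_distrib matrix_vector_mul_assoc
        flip: One_nat_def)
qed

lemma end_state_add_scaleR: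
  "end_state M B y N (\<lambda>i. u i + t *\<^sub>R p i)
    = end_state M B y N u + t *\<^sub>R (\<Sum>i = 1..N. (mat_pow M (N - i) ** B) *v p i)"
  by (simp add: end_state_def matrix_vector_right_distrib sum.distrib matrix_vector_mult_scaleR
      flip: scaleR_sum_right)

lemma end_state_unique:
  assumes "\<And>i. i \<in> {1..N} \<Longrightarrow> x (i + 1) = M *v x i + B *v u i"
  shows "x (N + 1) = end_state M B (x 1) N u"
  using assms
proof (induction N)
  case (Suc N)
  then show ?case using Suc.prems[of "Suc N"] by (simp add: end_state_Suc)
qed (simp add: end_state_0)

lemma topspace_traj_space:
  "topspace (traj_space P) = ({1..num_pts P + 1} \<rightarrow>\<^sub>E UNIV) \<times> ({1..num_pts P} \<rightarrow>\<^sub>E UNIV) \<times> ({1..num_pts P} \<rightarrow>\<^sub>E UNIV)"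
  by (simp add: traj_space_def)

lemma relaxed_feasible_end_state:
  assumes "(x, u, \<sigma>) \<in> relaxed_feasible P"
  shows "x (num_pts P + 1) = end_state (sysA P) (sysB P) (x_init P) (num_pts P) u"
  using assms end_state_unique[of "num_pts P" x "sysA P" "sysB P" u]
  unfolding relaxed_feasible_def by auto

lemma relaxed_feasibleI:
  assumes "\<And>i. i \<in> {1..num_pts P} \<Longrightarrow> rho_min P \<le> s i \<and> s i \<le> rho_max P \<and> gfun P (u i) \<le> s i"
    and "bdry P (end_state (sysA P) (sysB P) (x_init P) (num_pts P) u) = 0"
  shows "\<exists>x. (x, restrict u {1..num_pts P}, restrict s {1..num_pts P}) \<in> relaxed_feasible P
    \<and> x (num_pts P + 1) = end_state (sysA P) (sysB P) (x_init P) (num_pts P) u"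
proof -
  \<comment> \<open>State \<open>i\<close> is reached after \<open>i - 1\<close> steps, since
    numbering starts at 1. \<open>restrict\<close> makes the functions extensional, as
    \<open>traj_space\<close> requires.\<close>
  let ?x = "restrict (\<lambda>i. end_state (sysA P) (sysB P) (x_init P) (i - 1) u) {1..num_pts P + 1}"
  have "?x (i + 1) = sysA P *v ?x i + sysB P *v u i" if "i \<in> {1..num_pts P}" for i
    using that end_state_Suc[of "sysA P" "sysB P" "x_init P" "i - 1" u] by auto
  then show ?thesis
    by (intro exI[of _ ?x])
      (use assms in \<open>auto simp: relaxed_feasible_def topspace_traj_space end_state_0\<close>)
qed

lemma bdry_convex_comb:
  assumes "ocp_data P" "bdry P y = 0" "bdry P w = 0"
  shows "bdry P (y + t *\<^sub>R (w - y)) = 0"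
proof -
  let ?L = "\<lambda>x. bdry P x - bdry P 0"
  have L: "linear ?L" using assms(1) by (simp add: ocp_data_def)
  have "?L (y + t *\<^sub>R (w - y)) = ?L y + t *\<^sub>R (?L w - ?L y)"
    by (simp only: linear_add[OF L] linear_scale[OF L] linear_diff[OF L])
  then show ?thesis using assms(2,3) by simp
qed

lemma convex_on_UNIV_add_scaleR:
  assumes "convex_on UNIV f" "0 \<le> t" "t \<le> 1"
  shows "f (y + t *\<^sub>R (w - y)) \<le> (1 - t) * f y + t * f w"
  using convex_onD[OF assms(1), of t y w] assms(2,3) by (simp add: algebra_simps)

lemma inj_on_diff_left:
  fixes T :: "nat set"
  assumes "T \<subseteq> {1..N}"
  shows "inj_on ((-) N) T"
  by (rule inj_onI) (use assms in \<open>metis atLeastAtMost_iff diff_diff_cancel subsetD\<close>)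

text \<open>At the grid points in \<open>T\<close> the control lies in the open set where \<open>gfun P\<close> is below
  \<open>rho_min P\<close>, so it can be varied freely and can compensate, in the terminal state, a
  simultaneous move of all \<open>\<sigma> i\<close> towards \<open>rho_min P\<close> and of the terminal state towards any
  \<open>w\<close> on the target set.\<close>

lemma steering_violations_imp_abnormal:
  fixes P :: "('nx::finite, 'nu::finite, 'ng::finite) ocp"
  assumes data: "ocp_data P" and reg: "A_reg P"
    and opt: "relaxed_optimal P (x, u, \<sigma>)"
    and T: "T \<subseteq> violations P u"
    and det: "Determinants.det (ctrl_gram ((-) (num_pts P) ` T) (sysA P) (sysB P)) \<noteq> 0"
  shows "(\<forall>i\<in>{1..num_pts P}. \<sigma> i = rho_min P) \<and> terminal_minimizer P (x (num_pts P + 1))"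
proof -
  let ?N = "num_pts P" and ?r = "rho_min P" and ?g = "gfun P" and ?m = "mcost P" and ?l = "lcost P"
  let ?A = "sysA P" and ?B = "sysB P"
  let ?end = "end_state ?A ?B (x_init P) ?N"
  define y where "y = x (?N + 1)"
  have feas: "(x, u, \<sigma>) \<in> relaxed_feasible P"
    and least: "\<And>z. z \<in> relaxed_feasible P \<Longrightarrow> relaxed_cost P (x, u, \<sigma>) \<le> relaxed_cost P z"
    using opt by (auto simp: relaxed_optimal_def)
  have y: "y = ?end u" unfolding y_def using relaxed_feasible_end_state[OF feas] .
  have con: "?r \<le> \<sigma> i" "\<sigma> i \<le> rho_max P" "?g (u i) \<le> \<sigma> i" if "i \<in> {1..?N}" for i
    using feas that unfolding relaxed_feasible_def by auto
  have by0: "bdry P y = 0" using feas unfolding relaxed_feasible_def y_def by auto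
  have TN: "T \<subseteq> {1..?N}" "finite T"
    using T finite_subset[of T "{1..?N}"] by (auto simp: violations_def subset_iff)
  \<comment> \<open>The relaxed constraints already bound g(u_i) by \<sigma>_i and hence by the
    upper limit, so only the lower limit can be violated.\<close>
  have gT: "?g (u i) < ?r" if "i \<in> T" for i
    using that T con[of i] unfolding violations_def by force
  have cg: "convex_on UNIV ?g" and cm: "convex_on UNIV ?m"
    and cl: "\<And>i. i \<in> {1..?N} \<Longrightarrow> convex_on UNIV (?l i)"
    using data by (auto simp: ocp_data_def)
  have lm: "\<And>i. i \<in> {1..?N} \<Longrightarrow> strict_mono_on {?r..} (?l i)"
    using reg by (auto simp: A_reg_def)
  have "({1..?N} \<rightarrow>\<^sub>E {v. ?g v \<le> ?r}) \<noteq> {}"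
    using reg unfolding A_reg_def by (elim conjE)
  then have "\<exists>u0. u0 \<in> {1..?N} \<rightarrow>\<^sub>E {v. ?g v \<le> ?r}"
    by (simp only: ex_in_conv not_False_eq_True)
  then obtain u0 where u0_PiE: "u0 \<in> {1..?N} \<rightarrow>\<^sub>E {v. ?g v \<le> ?r}" ..
  have u0: "?g (u0 i) \<le> ?r" if "i \<in> {1..?N}" for i
    using PiE_mem[OF u0_PiE that] by simp
  \<comment> \<open>The comparison point has the controls \<open>u0\<close>, corrected on
    \<open>T\<close> so as to end in \<open>w\<close>, and all \<sigma> at the lower limit. It may
    be infeasible on \<open>T\<close>, but the segment towards it is feasible near the optimum, and
    convexity carries the inequality to its end.\<close>
  have main: "?m y + (\<Sum>i = 1..?N. ?l i (\<sigma> i)) \<le> ?m w + (\<Sum>i = 1..?N. ?l i ?r)"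
    if w: "bdry P w = 0" for w
  proof -
    obtain v where v: "(\<Sum>k\<in>(-) ?N ` T. (mat_pow ?A k ** ?B) *v v k) = w - ?end u0"
      using det_gram_nonzero_surj[OF det[unfolded ctrl_gram_def]] by blast
    define v' where "v' i = (if i \<in> T then v (?N - i) else 0)" for i
    \<comment> \<open>The direction from \<open>u\<close> to the corrected controls; off
      \<open>T\<close>, moving along it forms convex combinations of \<open>u i\<close> and
      \<open>u0 i\<close>.\<close>
    define p where "p i = u0 i + v' i - u i" for i
    have "inj_on ((-) ?N) T" using TN(1) by (rule inj_on_diff_left)
    then have "w - ?end u0 = (\<Sum>i\<in>T. (mat_pow ?A (?N - i) ** ?B) *v v' i)"
      unfolding v[symmetric] by (subst sum.reindex) (auto simp: v'_def)
    also have "\<dots> = (\<Sum>i = 1..?N. (mat_pow ?A (?N - i) ** ?B) *v v' i)"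
      by (rule sum.mono_neutral_left) (use TN in \<open>auto simp: v'_def\<close>)
    finally have "(\<Sum>i = 1..?N. (mat_pow ?A (?N - i) ** ?B) *v p i) = w - y"
      unfolding p_def y
      by (simp add: end_state_def matrix_vector_mult_diff_distrib matrix_vector_right_distrib
          sum.distrib sum_subtractf algebra_simps)
    then have end': "?end (\<lambda>i. u i + t *\<^sub>R p i) = y + t *\<^sub>R (w - y)" for t
      unfolding end_state_add_scaleR y by simp
    have "\<forall>\<^sub>F t in at_right 0. ?g (u i + t *\<^sub>R p i) < ?r" if "i \<in> T" for i
    proof -
      have "continuous_on UNIV ?g" using cg by (intro convex_on_continuous) auto
      then have "isCont (\<lambda>t. ?g (u i + t *\<^sub>R p i)) 0"
        by (intro continuous_on_interior[of UNIV]) (auto intro!: continuous_intros continuous_on_compose2[of UNIV ?g])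
      then have "((\<lambda>t. ?g (u i + t *\<^sub>R p i)) \<longlongrightarrow> ?g (u i)) (at_right 0)"
        by (simp add: isCont_def filterlim_at_split)
      then show ?thesis using gT[OF that] by (rule order_tendstoD)
    qed
    then have "\<forall>\<^sub>F t in at_right 0. \<forall>i\<in>T. ?g (u i + t *\<^sub>R p i) < ?r"
      using TN by (intro eventually_ball_finite) auto
    moreover have "\<forall>\<^sub>F t in at_right (0::real). t \<in> {0<..<1}"
      by (rule eventually_at_right_real) simp
    ultimately have "\<forall>\<^sub>F t in at_right 0. t \<in> {0<..<1} \<and> (\<forall>i\<in>T. ?g (u i + t *\<^sub>R p i) < ?r)"
      by eventually_elim auto
    then obtain t :: real where t: "0 < t" "t < 1" and tT: "\<And>i. i \<in> T \<Longrightarrow> ?g (u i + t *\<^sub>R p i) < ?r"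
      using eventually_happens by force
    define s where "s i = \<sigma> i + t *\<^sub>R (?r - \<sigma> i)" for i
    have s: "?r \<le> s i" "s i \<le> \<sigma> i" if "i \<in> {1..?N}" for i
    proof -
      have "s i - ?r = (1 - t) * (\<sigma> i - ?r)" "\<sigma> i - s i = t * (\<sigma> i - ?r)"
        by (simp_all add: s_def algebra_simps)
      then show "?r \<le> s i" "s i \<le> \<sigma> i" using t con(1)[OF that]
        by (smt (verit) mult_nonneg_nonneg)+
    qed
    have gs: "?g (u i + t *\<^sub>R p i) \<le> s i" if i: "i \<in> {1..?N}" for i
    proof (cases "i \<in> T")
      case True
      then show ?thesis using tT[OF True] s(1)[OF i] by simp
    next
      case False
      then have "?g (u i + t *\<^sub>R p i) \<le> (1 - t) * ?g (u i) + t * ?g (u0 i)"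
        using convex_on_UNIV_add_scaleR[OF cg, of t "u i" "u0 i"] t by (simp add: p_def v'_def)
      also have "\<dots> \<le> (1 - t) * \<sigma> i + t * ?r"
        using t con(3)[OF i] u0[OF i] by (intro add_mono mult_left_mono) auto
      finally show ?thesis by (simp add: s_def algebra_simps)
    qed
    have "bdry P (?end (\<lambda>i. u i + t *\<^sub>R p i)) = 0"
      unfolding end' by (rule bdry_convex_comb[OF data by0 w])
    then obtain x' where x': "(x', restrict (\<lambda>i. u i + t *\<^sub>R p i) {1..?N}, restrict s {1..?N}) \<in> relaxed_feasible P"
      "x' (?N + 1) = y + t *\<^sub>R (w - y)"
      using relaxed_feasibleI[of P s "\<lambda>i. u i + t *\<^sub>R p i"] s gs con(2) unfolding end'
      by (meson order_trans)
    \<comment> \<open>Optimality against the point at parameter \<open>t\<close>, then convexity;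
      cancelling the share \<open>1 - t\<close> of the optimal cost and dividing by \<open>t\<close>
      yields the claim.\<close>
    have "?m y + (\<Sum>i = 1..?N. ?l i (\<sigma> i)) \<le> ?m (y + t *\<^sub>R (w - y)) + (\<Sum>i = 1..?N. ?l i (s i))"
      using least[OF x'(1)] x'(2) by (simp add: relaxed_cost_def y_def)
    also have "\<dots> \<le> ((1 - t) * ?m y + t * ?m w) + (\<Sum>i = 1..?N. (1 - t) * ?l i (\<sigma> i) + t * ?l i ?r)"
      unfolding s_def using t cm cl
      by (intro add_mono sum_mono convex_on_UNIV_add_scaleR) auto
    also have "\<dots> = (1 - t) * (?m y + (\<Sum>i = 1..?N. ?l i (\<sigma> i))) + t * (?m w + (\<Sum>i = 1..?N. ?l i ?r))"
      by (simp add: sum.distrib sum_distrib_left distrib_left)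
    finally have "t * (?m y + (\<Sum>i = 1..?N. ?l i (\<sigma> i))) \<le> t * (?m w + (\<Sum>i = 1..?N. ?l i ?r))"
      by (simp add: left_diff_distrib)
    then show ?thesis using t by simp
  qed
  \<comment> \<open>For \<open>w = y\<close> the terminal costs cancel in \<open>main\<close>, and
    strict monotonicity of the running costs leaves no \<sigma> above the lower limit.\<close>
  have sig: "\<sigma> i = ?r" if i: "i \<in> {1..?N}" for i
  proof (rule ccontr)
    assume "\<sigma> i \<noteq> ?r"
    then have "?l i ?r < ?l i (\<sigma> i)" using con(1)[OF i] lm[OF i] by (auto simp: strict_mono_on_def)
    moreover have "?l j ?r \<le> ?l j (\<sigma> j)" if "j \<in> {1..?N}" for j
      using con(1)[OF that] lm[OF that] by (auto intro: monotone_onD[OF strict_mono_on_imp_mono_on])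
    ultimately have "(\<Sum>i = 1..?N. ?l i ?r) < (\<Sum>i = 1..?N. ?l i (\<sigma> i))"
      using i by (intro sum_strict_mono_ex1) auto
    then show False using main[OF by0] by simp
  qed
  then have "(\<Sum>i = 1..?N. ?l i (\<sigma> i)) = (\<Sum>i = 1..?N. ?l i ?r)" by (intro sum.cong) auto
  then have "terminal_minimizer P y" using by0 main by (simp add: terminal_minimizer_def)
  then show ?thesis using sig by (simp add: y_def)
qed

text \<open>Setting every \<sigma> to the lower limit minimizes each running cost. If the terminal
  state also minimized (P7), the trajectory would be an optimal one of the kind that normality
  excludes.\<close>

lemma not_terminal_minimizer_of_normal:
  assumes reg: "A_reg P" and normal: "A_normal P" and le: "rho_min P \<le> rho_max P"
    and u: "u \<in> {1..num_pts P} \<rightarrow>\<^sub>E {v. gfun P v \<le> rho_min P}"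
  shows "\<not> terminal_minimizer P (end_state (sysA P) (sysB P) (x_init P) (num_pts P) u)"
proof
  let ?y = "end_state (sysA P) (sysB P) (x_init P) (num_pts P) u"
  let ?\<sigma> = "restrict (\<lambda>_. rho_min P) {1..num_pts P}"
  assume min: "terminal_minimizer P ?y"
  have "gfun P (u i) \<le> rho_min P" if "i \<in> {1..num_pts P}" for i
    using PiE_mem[OF u that] by simp
  moreover have ur: "restrict u {1..num_pts P} = u" using u by (auto simp: PiE_def extensional_restrict)
  ultimately obtain x where x: "(x, u, ?\<sigma>) \<in> relaxed_feasible P" "x (num_pts P + 1) = ?y"
    using relaxed_feasibleI[of P "\<lambda>_. rho_min P" u] min le by (auto simp: terminal_minimizer_def)
  have "relaxed_cost P (x, u, ?\<sigma>) \<le> relaxed_cost P (x', u', \<sigma>')"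
    if f: "(x', u', \<sigma>') \<in> relaxed_feasible P" for x' u' \<sigma>'
  proof -
    have "mcost P ?y \<le> mcost P (x' (num_pts P + 1))"
      using min f by (auto simp: terminal_minimizer_def relaxed_feasible_def)
    moreover have "(\<Sum>i = 1..num_pts P. lcost P i (rho_min P)) \<le> (\<Sum>i = 1..num_pts P. lcost P i (\<sigma>' i))"
    proof (rule sum_mono)
      fix i assume i: "i \<in> {1..num_pts P}"
      then have "rho_min P \<le> \<sigma>' i" using f by (auto simp: relaxed_feasible_def)
      moreover have "strict_mono_on {rho_min P..} (lcost P i)" using reg i by (auto simp: A_reg_def)
      ultimately show "lcost P i (rho_min P) \<le> lcost P i (\<sigma>' i)"
        by (auto intro: monotone_onD[OF strict_mono_on_imp_mono_on])
    qed
    ultimately show ?thesis using x(2) by (simp add: relaxed_cost_def)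
  qed
  then have "relaxed_optimal P (x, u, ?\<sigma>)" using x(1) by (auto simp: relaxed_optimal_def)
  then show False using normal min x(2) unfolding A_normal_def by fastforce
qed

lemma closed_terminal_minimizer:
  assumes "ocp_data P"
  shows "closed {y. terminal_minimizer P y}"
proof -
  have "linear (\<lambda>x. bdry P x - bdry P 0)" using assms by (simp add: ocp_data_def)
  then have "continuous_on UNIV (\<lambda>x. (bdry P x - bdry P 0) + bdry P 0)"
    by (intro continuous_intros linear_continuous_on linear_conv_bounded_linear[THEN iffD1])
  then have b: "continuous_on UNIV (bdry P)" by simp
  have "convex_on UNIV (mcost P)" using assms by (simp add: ocp_data_def)
  then have m: "continuous_on UNIV (mcost P)" by (intro convex_on_continuous) auto
  have "{y. terminal_minimizer P y} = {y. bdry P y = 0} \<inter> (\<Inter>w\<in>{w. bdry P w = 0}. {y. mcost P y \<le> mcost P w})"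
    by (auto simp: terminal_minimizer_def)
  moreover have "closed \<dots>"
    by (intro closed_Int closed_INT ballI closed_Collect_eq closed_Collect_le b m continuous_intros)
  ultimately show ?thesis by simp
qed

text \<open>Stated with \<open>continuous_map\<close> because the controls range over a product
  topology on extensional functions rather than over a topological type.\<close>

lemma continuous_map_matrix_vector_mult:
  fixes F :: "'a \<Rightarrow> real^'n^'m"
  assumes "continuous_map X euclidean F" "continuous_map X euclidean G"
  shows "continuous_map X euclidean (\<lambda>z. F z *v G z)"
proof -
  have "continuous_on UNIV (\<lambda>z :: (real^'n^'m) \<times> (real^'n). fst z *v snd z)"
    unfolding matrix_vector_mult_def by (intro continuous_intros)
  then have "continuous_map (prod_topology euclidean euclidean) euclidean (\<lambda>z :: (real^'n^'m) \<times> (real^'n). fst z *v snd z)"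
    by simp
  then have "continuous_map X euclidean ((\<lambda>z. fst z *v snd z) \<circ> (\<lambda>z. (F z, G z)))"
    using assms by (intro continuous_map_compose[where X'="prod_topology euclidean euclidean"] continuous_map_pairedI)
  then show ?thesis by (simp add: o_def)
qed

text \<open>The bad parameters form the projection of a closed set along a compact set of controls.\<close>

lemma open_no_terminal_minimizer:
  fixes P :: "('nx::finite, 'nu::finite, 'ng::finite) ocp"
    and \<A> :: "'a::topological_space \<Rightarrow> real^'nx^'nx"
  assumes data: "ocp_data P" and reg: "A_reg P" and le: "rho_min P \<le> rho_max P"
    and cont: "continuous_on UNIV \<A>"
  shows "open {q. \<forall>u \<in> {1..num_pts P} \<rightarrow>\<^sub>E {v. gfun P v \<le> rho_min P}.
    \<not> terminal_minimizer P (end_state (\<A> q) (sysB P) (x_init P) (num_pts P) u)}"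
proof -
  let ?N = "num_pts P"
  let ?I = "{1..?N}"
  let ?Pt = "product_topology (\<lambda>_. euclidean) ?I :: (nat \<Rightarrow> real^'nu) topology"
  define C where "C = (?I \<rightarrow>\<^sub>E {v. gfun P v \<le> rho_min P})"
  define T where "T = subtopology ?Pt C"
  let ?X = "prod_topology (euclidean :: 'a topology) T"
  let ?f = "\<lambda>z. end_state (\<A> (fst z)) (sysB P) (x_init P) ?N (snd z)"
  have "convex_on UNIV (gfun P)" using data by (simp add: ocp_data_def)
  then have "continuous_on UNIV (gfun P)" by (intro convex_on_continuous) auto
  then have "closed {v. gfun P v \<le> rho_min P}"
    by (intro closed_Collect_le continuous_intros)
  then have "closedin ?Pt C" unfolding C_def by (auto simp: closedin_product_topology)
  \<comment> \<open>\<open>C\<close> is a closed subset of the set of controls whose compactness is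
    part of \<open>A_reg\<close>.\<close>
  moreover have "C \<subseteq> (?I \<rightarrow>\<^sub>E {v. gfun P v \<le> rho_max P})"
    unfolding C_def using le by (intro PiE_mono) auto
  moreover have "compactin ?Pt (?I \<rightarrow>\<^sub>E {v. gfun P v \<le> rho_max P})"
    using reg by (simp add: A_reg_def)
  ultimately have "compactin ?Pt C" by (metis closed_compactin)
  then have "compact_space T" unfolding T_def by (simp add: compactin_subspace)
  \<comment> \<open>Projection along a compact factor is a closed map; this is what makes the set of
    bad parameters closed.\<close>
  then have cmap: "closed_map ?X euclidean fst" by (rule Abstract_Topological_Spaces.closed_map_fst)
  have fstq: "continuous_map ?X euclidean (\<lambda>z. h (\<A> (fst z)))"
    if "continuous_on UNIV h" for h :: "_ \<Rightarrow> 'c::topological_space"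
  proof -
    have "continuous_map euclidean euclidean (\<lambda>q. h (\<A> q))"
      using cont that by (simp add: continuous_on_compose2[of UNIV h])
    then have "continuous_map ?X euclidean ((\<lambda>q. h (\<A> q)) \<circ> fst)"
      by (intro continuous_map_compose[OF continuous_map_fst])
    then show ?thesis by (simp add: o_def)
  qed
  have sndu: "continuous_map ?X euclidean (\<lambda>z. snd z i)" if "i \<in> ?I" for i
  proof -
    have "continuous_map ?X T snd" by (rule continuous_map_snd)
    then have "continuous_map ?X ?Pt snd" unfolding T_def by (rule continuous_map_into_fulltopology)
    then have "continuous_map ?X euclidean ((\<lambda>f. f i) \<circ> snd)"
      by (rule continuous_map_compose) (rule continuous_map_product_projection[OF that])
    then show ?thesis by (simp add: o_def)
  qed
  have pow: "continuous_map ?X euclidean (\<lambda>z. mat_pow (\<A> (fst z)) k)" for k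
    by (rule fstq) (intro continuous_intros)
  have powB: "continuous_map ?X euclidean (\<lambda>z. mat_pow (\<A> (fst z)) k ** sysB P)" for k
    by (rule fstq) (intro continuous_intros)
  have "continuous_map ?X euclidean ?f"
    unfolding end_state_def
    by (intro continuous_map_add continuous_map_sum continuous_map_matrix_vector_mult
        pow powB sndu) auto
  then have "closedin ?X {z \<in> topspace ?X. ?f z \<in> {y. terminal_minimizer P y}}"
    by (rule closedin_continuous_map_preimage) (simp add: closed_terminal_minimizer[OF data])
  with cmap have "closed (fst ` {z \<in> topspace ?X. ?f z \<in> {y. terminal_minimizer P y}})"
    by (auto simp: closed_map_def)
  then have "open (- (fst ` {z \<in> topspace ?X. ?f z \<in> {y. terminal_minimizer P y}}))"
    by (rule open_Compl)
  moreover have "topspace T = C" unfolding T_def C_def by (auto simp: PiE_def)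
  ultimately show ?thesis unfolding C_def[symmetric]
    by (elim back_subst[where P = "open"]) (auto simp: image_iff)
qed

text \<open>The Slater point satisfies both bounds at grid point 1.\<close>

lemma rho_min_le_rho_max:
  assumes "A_Slater P K" "1 \<le> num_pts P"
  shows "rho_min P \<le> rho_max P"
proof -
  obtain z where "z \<in> V_tilde P"
    using assms(1) interior_of_subset[of "traj_space P" "V_tilde P"] unfolding A_Slater_def by blast
  then obtain x u \<sigma> where "\<forall>i\<in>{1..num_pts P}. (u i, \<sigma> i) \<in> V_set P"
    unfolding V_tilde_def by blast
  then have "(u 1, \<sigma> 1) \<in> V_set P" using assms(2) by simp
  then show ?thesis by (simp add: V_set_def)
qed

section \<open>The perturbed problem and the exceptional set of parameters\<close>

lemma perturbed_ocp_simps [simp]: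
  "sysA (perturbed_ocp P Q bs ev q) = perturbed_matrix Q bs ev q"
  "sysB (perturbed_ocp P Q bs ev q) = sysB P"
  "x_init (perturbed_ocp P Q bs ev q) = x_init P"
  "num_pts (perturbed_ocp P Q bs ev q) = num_pts P"
  "rho_min (perturbed_ocp P Q bs ev q) = rho_min P"
  "rho_max (perturbed_ocp P Q bs ev q) = rho_max P"
  "mcost (perturbed_ocp P Q bs ev q) = mcost P"
  "gfun (perturbed_ocp P Q bs ev q) = gfun P"
  "lcost (perturbed_ocp P Q bs ev q) = lcost P"
  "bdry (perturbed_ocp P Q bs ev q) = bdry P"
  by (simp_all add: perturbed_ocp_def)

lemma perturbed_ocp_invariants:
  "ocp_data (perturbed_ocp P Q bs ev q) = ocp_data P"
  "A_reg (perturbed_ocp P Q bs ev q) = A_reg P"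
  "terminal_minimizer (perturbed_ocp P Q bs ev q) = terminal_minimizer P"
  "violations (perturbed_ocp P Q bs ev q) = violations P"
  by (simp_all add: ocp_data_def A_reg_def terminal_minimizer_def violations_def fun_eq_iff)

text \<open>Completeness of Lebesgue measure makes \<open>S\<close> measurable for free, so the set
  of bad parameters only has to be covered by a null set.\<close>

lemma null_sets_uniform_measure_lebesgue:
  fixes C :: "'a::euclidean_space set"
  assumes "Z \<in> null_sets lborel" "S \<subseteq> Z" "C \<in> sets lebesgue"
  shows "S \<in> null_sets (uniform_measure lebesgue C)"
proof -
  have Z: "Z \<in> null_sets lebesgue" using assms(1) by (rule null_sets_completionI)
  have "S \<in> null_sets lebesgue" "C \<inter> S \<in> null_sets lebesgue"
    by (rule null_sets_completion_subset[OF _ Z]; use assms(2) in blast)+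
  then show ?thesis using assms(3) by (simp add: null_sets_def)
qed

theorem theorem20:
  fixes P :: "('nx::finite, 'nu::finite, 'ng::finite) ocp"
    and K :: "'ng set"
    and Q :: "complex^'nx^'nx"
    and bs :: "(nat \<times> complex) list"
    and ev :: "'d::finite \<Rightarrow> complex"
  assumes "ocp_data P"
    and "A_reg P"
    and "A_rank P K"
    and "A_Slater P K"
    and "A_normal P"
    and "controllable (sysA P) (sysB P)"
    and "jordan_form (sysA P) Q bs"
    and "bij_betw ev UNIV (eigenvalues (sysA P))"
  shows "\<exists>\<epsilon>>0.
    {q \<in> cube \<epsilon>. \<exists>x u \<sigma>. relaxed_optimal (perturbed_ocp P Q bs ev q) (x, u, \<sigma>) \<and>
        card (violations P u) > CARD('nx) - 1}
      \<in> null_sets (uniform_measure lebesgue (cube \<epsilon>))"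
proof (cases "1 \<le> num_pts P")
  case False
  \<comment> \<open>Without grid points nothing can be violated. The case is split off because the
    order of the two limits is derived from a grid point.\<close>
  then have "{1..num_pts P} = {}" by simp
  then have "violations P u = {}" for u unfolding violations_def by blast
  then have "\<not> card (violations P u) > CARD('nx) - 1" for u by simp
  then show ?thesis
    by (intro exI[of _ 1]) (simp only: simp_thms zero_less_one empty_def[symmetric] null_sets.empty_sets)
next
  case True
  let ?N = "num_pts P"
  let ?A = "perturbed_matrix Q bs ev"
  let ?bad = "\<lambda>\<epsilon>. {q \<in> cube \<epsilon>. \<exists>x u \<sigma>. relaxed_optimal (perturbed_ocp P Q bs ev q) (x, u, \<sigma>) \<and>
        card (violations P u) > CARD('nx) - 1}"
  let ?sing = "\<lambda>\<delta> S. {q \<in> cube \<delta>. Determinants.det (ctrl_gram S (?A q) (sysB P)) = 0}"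
  note le = rho_min_le_rho_max[OF assms(4) True]
  obtain \<delta> where "\<delta> > 0 \<and>
      (\<forall>S. finite S \<and> card S = CARD('nx) \<longrightarrow> ?sing \<delta> S \<in> null_sets lborel)"
    using perturbed_reachability_generic[OF assms(7,6), where ev = ev] ..
  then have \<delta>: "\<delta> > 0"
      "\<forall>S. finite S \<and> card S = CARD('nx) \<longrightarrow> ?sing \<delta> S \<in> null_sets lborel"
    by (rule conjunct1, rule conjunct2)
  let ?U = "{q. \<forall>u \<in> {1..?N} \<rightarrow>\<^sub>E {v. gfun P v \<le> rho_min P}.
    \<not> terminal_minimizer P (end_state (?A q) (sysB P) (x_init P) ?N u)}"
  have "open ?U"
    by (rule open_no_terminal_minimizer[OF assms(1,2) le continuous_on_perturbed_matrix[OF assms(7)]])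
  moreover have "0 \<in> ?U"
    using not_terminal_minimizer_of_normal[OF assms(2,5) le] by (simp add: perturbed_matrix_0[OF assms(7)])
  ultimately obtain \<delta>' where \<delta>': "\<delta>' > 0" "cube \<delta>' \<subseteq> ?U"
    using cube_subset_open by blast
  define \<epsilon> where "\<epsilon> = min \<delta> \<delta>'"
  \<comment> \<open>There are finitely many such \<open>T\<close>, and the reflection of
    \<open>i\<close> to \<open>N - i\<close> turns grid points into exponents of the system
    matrix.\<close>
  let ?\<T> = "{T. T \<subseteq> {1..?N} \<and> card T = CARD('nx)}"
  have "?bad \<epsilon> \<subseteq> (\<Union>T\<in>?\<T>. ?sing \<delta> ((-) ?N ` T))"
  proof
    fix q assume q: "q \<in> ?bad \<epsilon>"
    let ?P = "perturbed_ocp P Q bs ev q"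
    from q obtain x u \<sigma> where opt: "relaxed_optimal ?P (x, u, \<sigma>)"
      and card: "card (violations P u) > CARD('nx) - 1" by blast
    have q\<delta>: "q \<in> cube \<delta>" and qU: "q \<in> ?U"
      using q cube_mono[of \<epsilon> \<delta>] cube_mono[of \<epsilon> \<delta>'] \<delta>'(2) by (auto simp: \<epsilon>_def)
    obtain T where T: "T \<subseteq> violations P u" "card T = CARD('nx)"
      using card obtain_subset_with_card_n[of "CARD('nx)" "violations P u"] by force
    have "Determinants.det (ctrl_gram ((-) ?N ` T) (?A q) (sysB P)) = 0"
    proof (rule ccontr)
      assume "Determinants.det (ctrl_gram ((-) ?N ` T) (?A q) (sysB P)) \<noteq> 0"
      then have sig: "\<And>i. i \<in> {1..?N} \<Longrightarrow> \<sigma> i = rho_min P"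
        and min: "terminal_minimizer P (x (?N + 1))"
        using steering_violations_imp_abnormal[of ?P x u \<sigma> T] opt T(1) assms(1,2)
        by (simp_all add: perturbed_ocp_invariants)
      have feas: "(x, u, \<sigma>) \<in> relaxed_feasible ?P" using opt by (simp add: relaxed_optimal_def)
      \<comment> \<open>With all \<sigma> at the lower limit, \<open>u\<close> is one of the
        controls over which \<open>?U\<close> quantifies, and \<open>q\<close> lies in
        \<open>?U\<close>.\<close>
      have "u \<in> {1..?N} \<rightarrow>\<^sub>E {v. gfun P v \<le> rho_min P}"
        using feas sig by (auto simp: relaxed_feasible_def topspace_traj_space PiE_iff)
      then show False
        using qU min relaxed_feasible_end_state[OF feas] by simp
    qed
    moreover have "T \<in> ?\<T>" using T by (auto simp: violations_def)
    ultimately show "q \<in> (\<Union>T\<in>?\<T>. ?sing \<delta> ((-) ?N ` T))" using q\<delta> by blast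
  qed
  moreover have "(\<Union>T\<in>?\<T>. ?sing \<delta> ((-) ?N ` T)) \<in> null_sets lborel"
  proof (rule null_sets.finite_UN)
    show "?sing \<delta> ((-) ?N ` T) \<in> null_sets lborel" if "T \<in> ?\<T>" for T
    proof (rule \<delta>(2)[rule_format], rule conjI)
      show "finite ((-) ?N ` T)" using that finite_subset[of T "{1..?N}"] by auto
      show "card ((-) ?N ` T) = CARD('nx)"
        using that by (simp add: card_image inj_on_diff_left)
    qed
  qed (auto intro: finite_subset[of _ "Pow {1..?N}"])
  moreover have "(cube \<epsilon> :: (real^'d) set) \<in> sets lebesgue"
    by (rule sets_completionI_sets) (simp add: closed_cube)
  ultimately have "?bad \<epsilon> \<in> null_sets (uniform_measure lebesgue (cube \<epsilon>))"
    by (intro null_sets_uniform_measure_lebesgue)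
  moreover have "\<epsilon> > 0" using \<delta>(1) \<delta>'(1) by (simp add: \<epsilon>_def)
  ultimately show ?thesis by blast
qed

end
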